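(* Let $\mathbb{A}$ be a regular category and let $\mathbb{C}$ be a projective cover of $\mathbb{A}$. Then $\mathbb{A}$ is a Goursat category if and only if $\mathbb{C}$ is a weak Goursat category.
   Context: A category with finite limits is regular if kernel pairs have coequalizers and regular epimorphisms are stable under pullback. In a regular category, a relation from $X$ to $Y$ is a subobject of $X\times Y$, and relations $R\rightarrowtail X\times Y$ and $S\rightarrowtail Y\times Z$ have a relational composite $SR\rightarrowtail X\times Z$. A relation $R$ on $X$ (that is, from $X$ to $X$) is an equivalence relation if it is reflexive ($1_X\leqslant R$), symmetric ($R^o\leqslant R$, where $R^o$ is the opposite relation) and transitive ($RR\leqslant R$). A regular category is a Goursat category if $RSR=SRS$ for any pair of equivalence relations $R$ and $S$ on the same object. An object $P$ of a category is (regular) projective if for any arrow $f:P\to X$ and any regular epimorphism $g:Y\to X$ there is an arrow $h:P\to Y$ with $gh=f$. A full subcategory $\mathbb{C}$ of $\mathbb{A}$ is a projective cover of $\mathbb{A}$ if every object of $\mathbb{C}$ is regular projective in $\mathbb{A}$ and for every object $X$ of $\mathbb{A}$ there are an object $C$ of $\mathbb{C}$ and a regular epimorphism $C\to X$ in $\mathbb{A}$. Weak limits are defined like limits, but dropping the uniqueness of the factorization. A category is weakly lex if it has weak finite limits; a projective cover of a regular category is weakly lex. Let $\mathbb{C}$ be weakly lex. A pseudo-relation on an object $X$ of $\mathbb{C}$ is a pair of parallel arrows $r_1,r_2:R\to X$ in $\mathbb{C}$ (not necessarily jointly monomorphic). It is reflexive if there is $r:X\to R$ with $r_1r=1_X=r_2r$;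 symmetric if there is $\sigma:R\to R$ with $r_2=r_1\sigma$ and $r_1=r_2\sigma$; transitive if, for a weak pullback $W$ with projections $p_1,p_2:W\to R$ satisfying $r_2p_1=r_1p_2$ (a weak pullback in $\mathbb{C}$ of $r_2$ along $r_1$), there is $t:W\to R$ with $r_1t=r_1p_1$ and $r_2t=r_2p_2$ (this does not depend on the choice of the weak pullback). A pseudo-equivalence relation is a pseudo-relation that is reflexive, symmetric and transitive. $\mathbb{C}$ is a weak Goursat category if, for any pseudo-equivalence relation $r_1,r_2:R\to X$ in $\mathbb{C}$ and any regular epimorphism $f:X\to Y$ in $\mathbb{C}$, the composite $fr_1,fr_2:R\to Y$ is also a pseudo-equivalence relation. Convention: when $\mathbb{C}$ is a projective cover of $\mathbb{A}$, "regular epimorphism in $\mathbb{C}$" means a morphism of $\mathbb{C}$ which is a regular epimorphism in $\mathbb{A}$ (equivalently, since objects of $\mathbb{C}$ are projective in $\mathbb{A}$, a split epimorphism in $\mathbb{C}$). *)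

theory Defs
  imports Main
begin

record ('o, 'm) cat =
  Obj :: "'o set"
  Arr :: "'m set"
  Dom :: "'m \<Rightarrow> 'o"
  Cod :: "'m \<Rightarrow> 'o"
  Ident :: "'o \<Rightarrow> 'm"
  Comp :: "'m \<Rightarrow> 'm \<Rightarrow> 'm"  (infixr "\<cdot>\<index>" 75)

definition hom :: "('o, 'm) cat \<Rightarrow> 'o \<Rightarrow> 'o \<Rightarrow> 'm set" where
  "hom C X Y = {f \<in> Arr C. Dom C f = X \<and> Cod C f = Y}"

locale category =
  fixes C :: "('o, 'm) cat" (structure)
  assumes Dom_Obj: "f \<in> Arr C \<Longrightarrow> Dom C f \<in> Obj C"
    and Cod_Obj: "f \<in> Arr C \<Longrightarrow> Cod C f \<in> Obj C"
    and Ident_hom: "X \<in> Obj C \<Longrightarrow> Ident C X \<in> hom C X X"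
    and Comp_hom: "f \<in> hom C X Y \<Longrightarrow> g \<in> hom C Y Z \<Longrightarrow> g \<cdot> f \<in> hom C X Z"
    and Comp_Ident_right: "f \<in> hom C X Y \<Longrightarrow> f \<cdot> Ident C X = f"
    and Comp_Ident_left: "f \<in> hom C X Y \<Longrightarrow> Ident C Y \<cdot> f = f"
    and Comp_assoc: "f \<in> hom C X Y \<Longrightarrow> g \<in> hom C Y Z \<Longrightarrow> h \<in> hom C Z U \<Longrightarrow>
      (h \<cdot> g) \<cdot> f = h \<cdot> (g \<cdot> f)"

definition full_subcategory :: "('o, 'm) cat \<Rightarrow> ('o, 'm) cat \<Rightarrow> bool" where
  "full_subcategory C A \<longleftrightarrow>
     category C \<and> Obj C \<subseteq> Obj A \<and>
     Arr C = {f \<in> Arr A. Dom A f \<in> Obj C \<and> Cod A f \<in> Obj C} \<and>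
     (\<forall>f\<in>Arr C. Dom C f = Dom A f \<and> Cod C f = Cod A f) \<and>
     (\<forall>X\<in>Obj C. Ident C X = Ident A X) \<and>
     (\<forall>f\<in>Arr C. \<forall>g\<in>Arr C. Dom C g = Cod C f \<longrightarrow> g \<cdot>\<^bsub>C\<^esub> f = g \<cdot>\<^bsub>A\<^esub> f)"

text \<open>Limits and weak limits of diagrams. A functor is given by its object part and its arrow
  part; a cone by its vertex and its legs. Every finite category is isomorphic to one whose objects
  and arrows are natural numbers, so it suffices to use these as shapes of finite diagrams.\<close>

definition is_functor ::
  "('i, 'a) cat \<Rightarrow> ('o, 'm) cat \<Rightarrow> ('i \<Rightarrow> 'o) \<Rightarrow> ('a \<Rightarrow> 'm) \<Rightarrow> bool" where
  "is_functor J C FO FA \<longleftrightarrow>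
     category J \<and> category C \<and>
     (\<forall>j\<in>Obj J. FO j \<in> Obj C) \<and>
     (\<forall>a\<in>Arr J. FA a \<in> hom C (FO (Dom J a)) (FO (Cod J a))) \<and>
     (\<forall>j\<in>Obj J. FA (Ident J j) = Ident C (FO j)) \<and>
     (\<forall>a\<in>Arr J. \<forall>b\<in>Arr J. Dom J b = Cod J a \<longrightarrow> FA (b \<cdot>\<^bsub>J\<^esub> a) = FA b \<cdot>\<^bsub>C\<^esub> FA a)"

definition is_cone ::
  "('i, 'a) cat \<Rightarrow> ('o, 'm) cat \<Rightarrow> ('i \<Rightarrow> 'o) \<Rightarrow> ('a \<Rightarrow> 'm) \<Rightarrow> 'o \<Rightarrow> ('i \<Rightarrow> 'm) \<Rightarrow> bool" where
  "is_cone J C FO FA L l \<longleftrightarrow>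
     L \<in> Obj C \<and>
     (\<forall>j\<in>Obj J. l j \<in> hom C L (FO j)) \<and>
     (\<forall>a\<in>Arr J. FA a \<cdot>\<^bsub>C\<^esub> l (Dom J a) = l (Cod J a))"

definition is_limit ::
  "('i, 'a) cat \<Rightarrow> ('o, 'm) cat \<Rightarrow> ('i \<Rightarrow> 'o) \<Rightarrow> ('a \<Rightarrow> 'm) \<Rightarrow> 'o \<Rightarrow> ('i \<Rightarrow> 'm) \<Rightarrow> bool" where
  "is_limit J C FO FA L l \<longleftrightarrow>
     is_cone J C FO FA L l \<and>
     (\<forall>M m. is_cone J C FO FA M m \<longrightarrow>
        (\<exists>!h. h \<in> hom C M L \<and> (\<forall>j\<in>Obj J. l j \<cdot>\<^bsub>C\<^esub> h = m j)))"

definition is_weak_limit ::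
  "('i, 'a) cat \<Rightarrow> ('o, 'm) cat \<Rightarrow> ('i \<Rightarrow> 'o) \<Rightarrow> ('a \<Rightarrow> 'm) \<Rightarrow> 'o \<Rightarrow> ('i \<Rightarrow> 'm) \<Rightarrow> bool" where
  "is_weak_limit J C FO FA L l \<longleftrightarrow>
     is_cone J C FO FA L l \<and>
     (\<forall>M m. is_cone J C FO FA M m \<longrightarrow>
        (\<exists>h. h \<in> hom C M L \<and> (\<forall>j\<in>Obj J. l j \<cdot>\<^bsub>C\<^esub> h = m j)))"

definition has_finite_limits :: "('o, 'm) cat \<Rightarrow> bool" where
  "has_finite_limits C \<longleftrightarrow>
     (\<forall>(J :: (nat, nat) cat) FO FA.
        is_functor J C FO FA \<and> finite (Obj J) \<and> finite (Arr J) \<longrightarrow>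
        (\<exists>L l. is_limit J C FO FA L l))"

definition weakly_lex :: "('o, 'm) cat \<Rightarrow> bool" where
  "weakly_lex C \<longleftrightarrow>
     category C \<and>
     (\<forall>(J :: (nat, nat) cat) FO FA.
        is_functor J C FO FA \<and> finite (Obj J) \<and> finite (Arr J) \<longrightarrow>
        (\<exists>L l. is_weak_limit J C FO FA L l))"

text \<open>In \<open>is_pullback C f g p q\<close> the square is \<open>f \<cdot> p = g \<cdot> q\<close>; the vertex is the common
  domain of \<open>p\<close> and \<open>q\<close>.\<close>

definition commuting_square :: "('o, 'm) cat \<Rightarrow> 'm \<Rightarrow> 'm \<Rightarrow> 'm \<Rightarrow> 'm \<Rightarrow> bool" where
  "commuting_square C f g p q \<longleftrightarrow>
     f \<in> Arr C \<and> g \<in> Arr C \<and> p \<in> Arr C \<and> q \<in> Arr C \<and>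
     Cod C f = Cod C g \<and> Dom C p = Dom C q \<and> Cod C p = Dom C f \<and> Cod C q = Dom C g \<and>
     f \<cdot>\<^bsub>C\<^esub> p = g \<cdot>\<^bsub>C\<^esub> q"

definition is_pullback :: "('o, 'm) cat \<Rightarrow> 'm \<Rightarrow> 'm \<Rightarrow> 'm \<Rightarrow> 'm \<Rightarrow> bool" where
  "is_pullback C f g p q \<longleftrightarrow>
     commuting_square C f g p q \<and>
     (\<forall>u v. commuting_square C f g u v \<longrightarrow>
        (\<exists>!h. h \<in> hom C (Dom C u) (Dom C p) \<and> p \<cdot>\<^bsub>C\<^esub> h = u \<and> q \<cdot>\<^bsub>C\<^esub> h = v))"

definition is_weak_pullback :: "('o, 'm) cat \<Rightarrow> 'm \<Rightarrow> 'm \<Rightarrow> 'm \<Rightarrow> 'm \<Rightarrow> bool" where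
  "is_weak_pullback C f g p q \<longleftrightarrow>
     commuting_square C f g p q \<and>
     (\<forall>u v. commuting_square C f g u v \<longrightarrow>
        (\<exists>h. h \<in> hom C (Dom C u) (Dom C p) \<and> p \<cdot>\<^bsub>C\<^esub> h = u \<and> q \<cdot>\<^bsub>C\<^esub> h = v))"

definition is_product :: "('o, 'm) cat \<Rightarrow> 'o \<Rightarrow> 'o \<Rightarrow> 'o \<Rightarrow> 'm \<Rightarrow> 'm \<Rightarrow> bool" where
  "is_product C X Y P p q \<longleftrightarrow>
     P \<in> Obj C \<and> p \<in> hom C P X \<and> q \<in> hom C P Y \<and>
     (\<forall>Z u v. u \<in> hom C Z X \<and> v \<in> hom C Z Y \<longrightarrow>
        (\<exists>!h. h \<in> hom C Z P \<and> p \<cdot>\<^bsub>C\<^esub> h = u \<and> q \<cdot>\<^bsub>C\<^esub> h = v))"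

definition is_mono :: "('o, 'm) cat \<Rightarrow> 'm \<Rightarrow> bool" where
  "is_mono C m \<longleftrightarrow>
     m \<in> Arr C \<and>
     (\<forall>Z. \<forall>u\<in>hom C Z (Dom C m). \<forall>v\<in>hom C Z (Dom C m). m \<cdot>\<^bsub>C\<^esub> u = m \<cdot>\<^bsub>C\<^esub> v \<longrightarrow> u = v)"

definition is_coequalizer :: "('o, 'm) cat \<Rightarrow> 'm \<Rightarrow> 'm \<Rightarrow> 'm \<Rightarrow> bool" where
  "is_coequalizer C u v q \<longleftrightarrow>
     u \<in> Arr C \<and> v \<in> Arr C \<and> Dom C u = Dom C v \<and> Cod C u = Cod C v \<and>
     q \<in> Arr C \<and> Dom C q = Cod C u \<and> q \<cdot>\<^bsub>C\<^esub> u = q \<cdot>\<^bsub>C\<^esub> v \<and>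
     (\<forall>h\<in>Arr C. Dom C h = Cod C u \<and> h \<cdot>\<^bsub>C\<^esub> u = h \<cdot>\<^bsub>C\<^esub> v \<longrightarrow>
        (\<exists>!k. k \<in> hom C (Cod C q) (Cod C h) \<and> k \<cdot>\<^bsub>C\<^esub> q = h))"

definition regular_epi :: "('o, 'm) cat \<Rightarrow> 'm \<Rightarrow> bool" where
  "regular_epi C q \<longleftrightarrow> (\<exists>u v. is_coequalizer C u v q)"

locale regular_category = category +
  assumes finite_limits: "has_finite_limits C"
    and kernel_pair_coequalizer: "is_pullback C f f p q \<Longrightarrow> \<exists>e. is_coequalizer C p q e"
    and regular_epi_stable: "regular_epi C g \<Longrightarrow> is_pullback C f g p q \<Longrightarrow> regular_epi C p"

text \<open>A subobject of \<open>X \<times> Y\<close> is represented by a monomorphism \<open>m\<close> into a product of \<open>X\<close> and \<open>Y\<close>,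
  which is recorded through its two components. Since subobjects are classes of monomorphisms,
  equality of relations is \<open>rel_eq\<close>, that is, \<open>\<le>\<close> in both directions, and not equality of pairs.\<close>

definition is_relation :: "('o, 'm) cat \<Rightarrow> 'o \<Rightarrow> 'o \<Rightarrow> 'm \<times> 'm \<Rightarrow> bool" where
  "is_relation C X Y R \<longleftrightarrow>
     (\<exists>P p q m. is_product C X Y P p q \<and> is_mono C m \<and> Cod C m = P \<and>
        fst R = p \<cdot>\<^bsub>C\<^esub> m \<and> snd R = q \<cdot>\<^bsub>C\<^esub> m)"

definition rel_le :: "('o, 'm) cat \<Rightarrow> 'm \<times> 'm \<Rightarrow> 'm \<times> 'm \<Rightarrow> bool" where
  "rel_le C R S \<longleftrightarrow>
     (\<exists>h. h \<in> hom C (Dom C (fst R)) (Dom C (fst S)) \<and>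
        fst S \<cdot>\<^bsub>C\<^esub> h = fst R \<and> snd S \<cdot>\<^bsub>C\<^esub> h = snd R)"

definition rel_eq :: "('o, 'm) cat \<Rightarrow> 'm \<times> 'm \<Rightarrow> 'm \<times> 'm \<Rightarrow> bool" where
  "rel_eq C R S \<longleftrightarrow> rel_le C R S \<and> rel_le C S R"

definition rel_id :: "('o, 'm) cat \<Rightarrow> 'o \<Rightarrow> 'm \<times> 'm" where
  "rel_id C X = (Ident C X, Ident C X)"

definition rel_op :: "'m \<times> 'm \<Rightarrow> 'm \<times> 'm" where
  "rel_op R = (snd R, fst R)"

text \<open>For \<open>R\<close> from \<open>X\<close> to \<open>Y\<close> and \<open>S\<close> from \<open>Y\<close> to \<open>Z\<close>, the composite \<open>S R\<close> is the regular image
  in \<open>X \<times> Z\<close> of the pullback of \<open>R\<close> and \<open>S\<close> over \<open>Y\<close>. In a regular category it exists and is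
  unique up to \<open>rel_eq\<close>; \<open>rel_comp C S R\<close> selects a representative.\<close>

definition is_rel_comp :: "('o, 'm) cat \<Rightarrow> 'm \<times> 'm \<Rightarrow> 'm \<times> 'm \<Rightarrow> 'm \<times> 'm \<Rightarrow> bool" where
  "is_rel_comp C S R T \<longleftrightarrow>
     is_relation C (Cod C (fst R)) (Cod C (snd S)) T \<and>
     (\<exists>p q e. is_pullback C (snd R) (fst S) p q \<and>
        regular_epi C e \<and> e \<in> hom C (Dom C p) (Dom C (fst T)) \<and>
        fst T \<cdot>\<^bsub>C\<^esub> e = fst R \<cdot>\<^bsub>C\<^esub> p \<and> snd T \<cdot>\<^bsub>C\<^esub> e = snd S \<cdot>\<^bsub>C\<^esub> q)"

definition rel_comp :: "('o, 'm) cat \<Rightarrow> 'm \<times> 'm \<Rightarrow> 'm \<times> 'm \<Rightarrow> 'm \<times> 'm" where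
  "rel_comp C S R = (SOME T. is_rel_comp C S R T)"

definition equivalence_relation :: "('o, 'm) cat \<Rightarrow> 'o \<Rightarrow> 'm \<times> 'm \<Rightarrow> bool" where
  "equivalence_relation C X R \<longleftrightarrow>
     is_relation C X X R \<and>
     rel_le C (rel_id C X) R \<and>
     rel_le C (rel_op R) R \<and>
     rel_le C (rel_comp C R R) R"

definition goursat_category :: "('o, 'm) cat \<Rightarrow> bool" where
  "goursat_category C \<longleftrightarrow>
     regular_category C \<and>
     (\<forall>X\<in>Obj C. \<forall>R S. equivalence_relation C X R \<and> equivalence_relation C X S \<longrightarrow>
        rel_eq C (rel_comp C R (rel_comp C S R)) (rel_comp C S (rel_comp C R S)))"

definition regular_projective :: "('o, 'm) cat \<Rightarrow> 'o \<Rightarrow> bool" where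
  "regular_projective C P \<longleftrightarrow>
     P \<in> Obj C \<and>
     (\<forall>X Y f g. f \<in> hom C P X \<and> g \<in> hom C Y X \<and> regular_epi C g \<longrightarrow>
        (\<exists>h. h \<in> hom C P Y \<and> g \<cdot>\<^bsub>C\<^esub> h = f))"

definition projective_cover :: "('o, 'm) cat \<Rightarrow> ('o, 'm) cat \<Rightarrow> bool" where
  "projective_cover A C \<longleftrightarrow>
     full_subcategory C A \<and>
     (\<forall>P\<in>Obj C. regular_projective A P) \<and>
     (\<forall>X\<in>Obj A. \<exists>P\<in>Obj C. \<exists>e. e \<in> hom A P X \<and> regular_epi A e)"

definition pseudo_relation :: "('o, 'm) cat \<Rightarrow> 'o \<Rightarrow> 'm \<Rightarrow> 'm \<Rightarrow> bool" where
  "pseudo_relation C X r1 r2 \<longleftrightarrow> (\<exists>R. r1 \<in> hom C R X \<and> r2 \<in> hom C R X)"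

definition pseudo_reflexive :: "('o, 'm) cat \<Rightarrow> 'o \<Rightarrow> 'm \<Rightarrow> 'm \<Rightarrow> bool" where
  "pseudo_reflexive C X r1 r2 \<longleftrightarrow>
     (\<exists>r. r \<in> hom C X (Dom C r1) \<and> r1 \<cdot>\<^bsub>C\<^esub> r = Ident C X \<and> r2 \<cdot>\<^bsub>C\<^esub> r = Ident C X)"

definition pseudo_symmetric :: "('o, 'm) cat \<Rightarrow> 'm \<Rightarrow> 'm \<Rightarrow> bool" where
  "pseudo_symmetric C r1 r2 \<longleftrightarrow>
     (\<exists>s. s \<in> hom C (Dom C r1) (Dom C r1) \<and> r2 = r1 \<cdot>\<^bsub>C\<^esub> s \<and> r1 = r2 \<cdot>\<^bsub>C\<^esub> s)"

definition pseudo_transitive :: "('o, 'm) cat \<Rightarrow> 'm \<Rightarrow> 'm \<Rightarrow> bool" where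
  "pseudo_transitive C r1 r2 \<longleftrightarrow>
     (\<exists>p1 p2 t. is_weak_pullback C r2 r1 p1 p2 \<and> t \<in> hom C (Dom C p1) (Dom C r1) \<and>
        r1 \<cdot>\<^bsub>C\<^esub> t = r1 \<cdot>\<^bsub>C\<^esub> p1 \<and> r2 \<cdot>\<^bsub>C\<^esub> t = r2 \<cdot>\<^bsub>C\<^esub> p2)"

definition pseudo_equivalence_relation :: "('o, 'm) cat \<Rightarrow> 'o \<Rightarrow> 'm \<Rightarrow> 'm \<Rightarrow> bool" where
  "pseudo_equivalence_relation C X r1 r2 \<longleftrightarrow>
     pseudo_relation C X r1 r2 \<and> pseudo_reflexive C X r1 r2 \<and>
     pseudo_symmetric C r1 r2 \<and> pseudo_transitive C r1 r2"

text \<open>The ambient category \<open>A\<close> enters because the regular epimorphisms of a projective cover \<open>C\<close>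
  of \<open>A\<close> are by convention the arrows of \<open>C\<close> that are regular epimorphisms in \<open>A\<close>.\<close>

definition weak_goursat_category :: "('o, 'm) cat \<Rightarrow> ('o, 'm) cat \<Rightarrow> bool" where
  "weak_goursat_category A C \<longleftrightarrow>
     weakly_lex C \<and>
     (\<forall>X Y r1 r2 f.
        pseudo_equivalence_relation C X r1 r2 \<and> f \<in> hom C X Y \<and> regular_epi A f \<longrightarrow>
        pseudo_equivalence_relation C Y (f \<cdot>\<^bsub>C\<^esub> r1) (f \<cdot>\<^bsub>C\<^esub> r2))"

end

theory Submission
  imports Defs
begin

text \<open>A relation \<open>R\<close> on \<open>X\<close> in \<open>A\<close> induces, for each \<open>P\<close> in the projective cover, an ordinary relation
  \<open>rel_at A P R\<close> on the set of arrows from \<open>P\<close> to \<open>X\<close>. Since every object is covered by such a \<open>P\<close>,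
  these set relations determine the order between relations; since every \<open>P\<close> is projective, they
  turn relational composites and regular images into composites and images of sets. They also detect
  both equivalence relations in \<open>A\<close> and pseudo-equivalence relations in the cover. The theorem thus
  becomes set-level: if \<open>R S R = S R S\<close> with \<open>S\<close> the kernel pair of \<open>f\<close>, then the image of \<open>R\<close> under
  \<open>f\<close> is transitive; conversely \<open>S R S\<close> is, up to a cover of \<open>X\<close>, the direct image along one leg of
  \<open>S\<close> of the inverse image of \<open>R\<close> along the other, so it is transitive and therefore contains
  \<open>R S R\<close>.\<close>

section \<open>Categories with pullbacks and products\<close>

context category
begin

lemma comp_arr [simp]:
  assumes "f \<in> Arr C" "g \<in> Arr C" "Cod C f = Dom C g"
  shows "g \<cdot> f \<in> Arr C" "Dom C (g \<cdot> f) = Dom C f" "Cod C (g \<cdot> f) = Cod C g"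
  using assms Comp_hom[of f "Dom C f" "Cod C f" g "Cod C g"] by (auto simp: hom_def)

lemma comp_assoc [simp]:
  assumes "f \<in> Arr C" "g \<in> Arr C" "h \<in> Arr C" "Cod C f = Dom C g" "Cod C g = Dom C h"
  shows "(h \<cdot> g) \<cdot> f = h \<cdot> (g \<cdot> f)"
  using assms Comp_assoc[of f "Dom C f" "Cod C f" g "Cod C g" h "Cod C h"] by (auto simp: hom_def)

lemma ident_arr [simp]:
  assumes "X \<in> Obj C"
  shows "Ident C X \<in> Arr C" "Dom C (Ident C X) = X" "Cod C (Ident C X) = X"
  using Ident_hom[OF assms] by (auto simp: hom_def)

lemma comp_ident [simp]:
  assumes "f \<in> Arr C"
  shows "f \<cdot> Ident C (Dom C f) = f" "Ident C (Cod C f) \<cdot> f = f"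
  using assms Comp_Ident_left Comp_Ident_right by (auto simp: hom_def)

text \<open>Both arrows factor the same composite through \<open>e\<close>, so the uniqueness clause
  of the coequalizer applies. Their common codomain is read off from the equality of the
  composites.\<close>

lemma regular_epi_cancel:
  assumes "regular_epi C e" "g \<in> Arr C" "h \<in> Arr C" "Dom C g = Cod C e" "Dom C h = Cod C e"
    and eq: "g \<cdot> e = h \<cdot> e"
  shows "g = h"
proof -
  from assms(1) obtain u v where uv: "is_coequalizer C u v e"
    by (auto simp: regular_epi_def)
  then have e: "u \<in> Arr C" "v \<in> Arr C" "e \<in> Arr C" "Dom C u = Dom C v" "Cod C u = Cod C v"
    "Dom C e = Cod C u" "e \<cdot> u = e \<cdot> v"
    by (auto simp: is_coequalizer_def)
  have cod: "Cod C g = Cod C h"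
    using eq e assms by (metis comp_arr(3))
  have "(g \<cdot> e) \<cdot> u = (g \<cdot> e) \<cdot> v"
    using e assms(2,4) by simp
  moreover have "g \<cdot> e \<in> Arr C" "Dom C (g \<cdot> e) = Cod C u" "Cod C (g \<cdot> e) = Cod C g"
    using e assms(2,4) by auto
  ultimately have "\<exists>!k. k \<in> hom C (Cod C e) (Cod C g) \<and> k \<cdot> e = g \<cdot> e"
    using uv unfolding is_coequalizer_def by metis
  then show ?thesis
    using assms cod by (auto simp: hom_def)
qed

text \<open>\<open>f\<close> is the coequalizer of \<open>Ident C X\<close> and
  \<open>s \<cdot> f\<close>: an arrow \<open>h\<close> with
  \<open>h = h \<cdot> (s \<cdot> f)\<close> factors through \<open>f\<close> by
  \<open>h \<cdot> s\<close>, and composing any factorization with the section \<open>s\<close>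
  shows that it is this one.\<close>

lemma split_epi_regular:
  assumes f: "f \<in> hom C X Y" and s: "s \<in> hom C Y X" and fs: "f \<cdot> s = Ident C Y"
  shows "regular_epi C f"
proof -
  have X: "X \<in> Obj C" and Y: "Y \<in> Obj C"
    using f Dom_Obj Cod_Obj by (auto simp: hom_def)
  have "f \<cdot> (s \<cdot> f) = (f \<cdot> s) \<cdot> f"
    using f s by (auto simp: hom_def)
  also have "\<dots> = f"
    using f fs by (auto simp: hom_def)
  finally have fsf: "f \<cdot> (s \<cdot> f) = f" .
  have "\<exists>!k. k \<in> hom C Y (Cod C h) \<and> k \<cdot> f = h"
    if h: "h \<in> Arr C" "Dom C h = X" "h \<cdot> Ident C X = h \<cdot> (s \<cdot> f)" for h
  proof (intro ex1I[of _ "h \<cdot> s"] conjI)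
    show "h \<cdot> s \<in> hom C Y (Cod C h)" "(h \<cdot> s) \<cdot> f = h"
      using f s h by (auto simp: hom_def)
    fix k assume k: "k \<in> hom C Y (Cod C h) \<and> k \<cdot> f = h"
    then have "h \<cdot> s = k \<cdot> (f \<cdot> s)"
      using f s by (auto simp: hom_def)
    then show "k = h \<cdot> s"
      using k fs by (auto simp: hom_def)
  qed
  then have "is_coequalizer C (Ident C X) (s \<cdot> f) f"
    unfolding is_coequalizer_def using f s X Y fsf by (auto simp: hom_def)
  then show ?thesis
    by (auto simp: regular_epi_def)
qed

end

section \<open>Pullbacks and binary products as limits of finite shapes\<close>

text \<open>Arrows 0, 1, 2 are the identities of the objects with the same numbers; 3 goes from 0 to
  2 and 4 from 1 to 2. In every composable pair at least one arrow is an identity: if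
  \<open>a\<close> is one the composite is \<open>b\<close>, and otherwise \<open>b\<close> is the
  identity of 2.\<close>

definition cospan_shape :: "(nat, nat) cat" where
  "cospan_shape = \<lparr>Obj = {0,1,2}, Arr = {0,1,2,3,4},
     Dom = (\<lambda>a. if a = 3 then 0 else if a = 4 then 1 else a),
     Cod = (\<lambda>a. if a < 3 then a else 2), Ident = (\<lambda>j. j),
     Comp = (\<lambda>b a. if a < 3 then b else a)\<rparr>"

definition pair_shape :: "(nat, nat) cat" where
  "pair_shape = \<lparr>Obj = {0,1}, Arr = {0,1}, Dom = (\<lambda>a. a), Cod = (\<lambda>a. a),
     Ident = (\<lambda>j. j), Comp = (\<lambda>b a. a)\<rparr>"

lemma category_cospan_shape: "category cospan_shape"
  by unfold_locales (auto simp: cospan_shape_def hom_def split: if_splits)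

lemma category_pair_shape: "category pair_shape"
  by unfold_locales (auto simp: pair_shape_def hom_def)

context regular_category
begin

lemma pullback_exists:
  assumes f: "f \<in> hom C X Z" and g: "g \<in> hom C Y Z"
  obtains p q where "is_pullback C f g p q"
proof -
  define FO where "FO = (\<lambda>j::nat. if j = 0 then X else if j = 1 then Y else Z)"
  define FA where "FA = (\<lambda>a::nat. if a = 3 then f else if a = 4 then g else Ident C (FO a))"
  have objs: "X \<in> Obj C" "Y \<in> Obj C" "Z \<in> Obj C"
    using f g Dom_Obj Cod_Obj by (auto simp: hom_def)
  have "is_functor cospan_shape C FO FA"
    unfolding is_functor_def using category_cospan_shape category_axioms f g objs
    by (auto simp: cospan_shape_def FO_def FA_def Comp_Ident_left Comp_Ident_right
        Ident_hom[THEN Comp_Ident_left] Ident_hom)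
  moreover have "finite (Obj cospan_shape)" "finite (Arr cospan_shape)"
    by (auto simp: cospan_shape_def)
  ultimately obtain L l where L: "is_limit cospan_shape C FO FA L l"
    using finite_limits unfolding has_finite_limits_def by blast
  have cone_iff: "is_cone cospan_shape C FO FA M m \<longleftrightarrow> M \<in> Obj C \<and>
      m 0 \<in> hom C M X \<and> m 1 \<in> hom C M Y \<and> m 2 \<in> hom C M Z \<and> f \<cdot> m 0 = m 2 \<and> g \<cdot> m 1 = m 2"
    for M m
    by (auto simp: is_cone_def cospan_shape_def FO_def FA_def Comp_Ident_left)
  have l: "l 0 \<in> hom C L X" "l 1 \<in> hom C L Y" "f \<cdot> l 0 = l 2" "g \<cdot> l 1 = l 2"
    using L by (auto simp: is_limit_def cone_iff)
  have "\<exists>!h. h \<in> hom C (Dom C u) (Dom C (l 0)) \<and> l 0 \<cdot> h = u \<and> l 1 \<cdot> h = v"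
    if uv: "commuting_square C f g u v" for u v
  proof -
    define m where "m = (\<lambda>j::nat. if j = 0 then u else if j = 1 then v else f \<cdot> u)"
    have "is_cone cospan_shape C FO FA (Dom C u) m"
      using uv f g by (auto simp: cone_iff m_def commuting_square_def hom_def Dom_Obj)
    then have "\<exists>!h. h \<in> hom C (Dom C u) L \<and> (\<forall>j\<in>Obj cospan_shape. l j \<cdot> h = m j)"
      using L by (auto simp: is_limit_def)
    \<comment> \<open>A mediating arrow for the limit must also match the leg at the corner 2. This
      follows from the leg at 0, since \<open>l 2\<close> is \<open>f \<cdot> l 0\<close>, so the
      two unique-existence statements agree.\<close>
    moreover have "(\<forall>j\<in>Obj cospan_shape. l j \<cdot> h = m j) \<longleftrightarrow> l 0 \<cdot> h = u \<and> l 1 \<cdot> h = v"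
      if "h \<in> hom C (Dom C u) L" for h
    proof -
      have "l 2 \<cdot> h = f \<cdot> (l 0 \<cdot> h)"
        using l(1) l(3)[symmetric] f that by (auto simp: hom_def)
      then show ?thesis
        by (auto simp: cospan_shape_def m_def)
    qed
    moreover have "Dom C (l 0) = L"
      using l by (simp add: hom_def)
    ultimately show ?thesis
      by (metis (no_types, lifting))
  qed
  moreover have "commuting_square C f g (l 0) (l 1)"
    using l f g by (auto simp: commuting_square_def hom_def)
  ultimately have "is_pullback C f g (l 0) (l 1)"
    by (auto simp: is_pullback_def)
  then show thesis ..
qed

lemma product_exists:
  assumes "X \<in> Obj C" "Y \<in> Obj C"
  obtains P p q where "is_product C X Y P p q"
proof -
  define FO where "FO = (\<lambda>j::nat. if j = 0 then X else Y)"
  define FA where "FA = (\<lambda>a. Ident C (FO a))"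
  have "is_functor pair_shape C FO FA"
    unfolding is_functor_def using category_pair_shape category_axioms assms
    by (auto simp: pair_shape_def FO_def FA_def Ident_hom[THEN Comp_Ident_left] Ident_hom)
  moreover have "finite (Obj pair_shape)" "finite (Arr pair_shape)"
    by (auto simp: pair_shape_def)
  ultimately obtain L l where L: "is_limit pair_shape C FO FA L l"
    using finite_limits unfolding has_finite_limits_def by blast
  have cone_iff: "is_cone pair_shape C FO FA M m \<longleftrightarrow>
      M \<in> Obj C \<and> m 0 \<in> hom C M X \<and> m 1 \<in> hom C M Y" for M m
    by (auto simp: is_cone_def pair_shape_def FO_def FA_def Comp_Ident_left)
  have "\<exists>!h. h \<in> hom C Z L \<and> l 0 \<cdot> h = u \<and> l 1 \<cdot> h = v"
    if uv: "u \<in> hom C Z X" "v \<in> hom C Z Y" for Z u v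
  proof -
    have "is_cone pair_shape C FO FA Z (\<lambda>j. if j = 0 then u else v)"
      using uv by (auto simp: cone_iff hom_def Dom_Obj)
    with L have "\<exists>!h. h \<in> hom C Z L \<and> (\<forall>j\<in>Obj pair_shape. l j \<cdot> h = (if j = 0 then u else v))"
      unfolding is_limit_def by blast
    then show ?thesis
      by (simp add: pair_shape_def)
  qed
  then have "is_product C X Y L (l 0) (l 1)"
    using L by (auto simp: is_product_def is_limit_def cone_iff)
  then show thesis ..
qed

end

section \<open>Relations on generalized elements\<close>

text \<open>This is what the representable functor at \<open>P\<close> sees of the span
  \<open>R\<close>. Several \<open>k\<close> may yield the same pair, so one formula serves
  relations and pseudo-relations alike.\<close>

definition rel_at :: "('o, 'm) cat \<Rightarrow> 'o \<Rightarrow> 'm \<times> 'm \<Rightarrow> ('m \<times> 'm) set" where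
  "rel_at C P R =
     {(fst R \<cdot>\<^bsub>C\<^esub> k, snd R \<cdot>\<^bsub>C\<^esub> k) | k. k \<in> hom C P (Dom C (fst R))}"

definition is_span :: "('o, 'm) cat \<Rightarrow> 'o \<Rightarrow> 'o \<Rightarrow> 'm \<times> 'm \<Rightarrow> bool" where
  "is_span C X Y R \<longleftrightarrow> fst R \<in> Arr C \<and> snd R \<in> Arr C \<and> Dom C (snd R) = Dom C (fst R) \<and>
     Cod C (fst R) = X \<and> Cod C (snd R) = Y"

section \<open>Equivalence relations on sets\<close>

text \<open>The three inclusions mirror the clauses of \<open>equivalence_relation\<close>, with
  \<open>rel_id\<close>, \<open>rel_op\<close> and \<open>rel_comp\<close> read at a fixed
  \<open>P\<close>.\<close>

lemma equiv_iff_subset: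
  assumes "r \<subseteq> B \<times> B"
  shows "equiv B r \<longleftrightarrow> Id_on B \<subseteq> r \<and> r\<inverse> \<subseteq> r \<and> r O r \<subseteq> r"
  using assms unfolding equiv_def refl_on_def sym_def trans_def by blast

lemma equiv_inverse_image:
  assumes r: "equiv B r" and g: "\<And>x. x \<in> D \<Longrightarrow> g x \<in> B"
  shows "equiv D {(x, y). x \<in> D \<and> y \<in> D \<and> (g x, g y) \<in> r}"
proof (rule equivI)
  show "refl_on D {(x, y). x \<in> D \<and> y \<in> D \<and> (g x, g y) \<in> r}"
    using r g by (simp add: equiv_def refl_on_def)
  show "sym {(x, y). x \<in> D \<and> y \<in> D \<and> (g x, g y) \<in> r}"
    using r by (auto simp: equiv_def intro!: symI dest: symD)
  show "trans {(x, y). x \<in> D \<and> y \<in> D \<and> (g x, g y) \<in> r}"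
    using r unfolding equiv_def trans_def by blast
qed auto

text \<open>Reflexivity and symmetry pass to any surjective image. For transitivity, two composable
  image pairs come from \<open>(a, b)\<close> and \<open>(c, d)\<close> in \<open>r\<close> with
  \<open>g b = g c\<close>; the kernel of \<open>g\<close> stands between them, and
  \<open>perm\<close> moves it to the two ends, where \<open>g\<close> erases it.\<close>

lemma equiv_image:
  assumes "equiv B r" and g: "g ` B = B'"
    and perm: "r O {(x, y). x \<in> B \<and> y \<in> B \<and> g x = g y} O r \<subseteq>
      {(x, y). x \<in> B \<and> y \<in> B \<and> g x = g y} O r O {(x, y). x \<in> B \<and> y \<in> B \<and> g x = g y}"
  shows "equiv B' (map_prod g g ` r)"
proof (rule equivI)
  have r: "r \<subseteq> B \<times> B" "refl_on B r" "sym r" "trans r"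
    using assms(1) by (auto simp: equiv_def)
  show "map_prod g g ` r \<subseteq> B' \<times> B'"
    using r(1) g by auto
  show "refl_on B' (map_prod g g ` r)"
    using r(2) g by (force simp: refl_on_def)
  show "sym (map_prod g g ` r)"
    using r(3) by (force simp: sym_def)
  show "trans (map_prod g g ` r)"
  proof (rule transI)
    fix x y z assume "(x, y) \<in> map_prod g g ` r" "(y, z) \<in> map_prod g g ` r"
    then obtain a b c d where "(a, b) \<in> r" "(c, d) \<in> r" "g a = x" "g b = g c" "g d = z"
      by (auto simp: image_iff)
    moreover from this have "b \<in> B" "c \<in> B"
      using r(1) by auto
    ultimately have "(a, d) \<in> r O {(x, y). x \<in> B \<and> y \<in> B \<and> g x = g y} O r"
      by blast
    then obtain a' d' where "(a', d') \<in> r" "g a' = g a" "g d' = g d"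
      using perm by (smt (verit) mem_Collect_eq case_prod_conv relcompE subset_iff prod.inject)
    then show "(x, z) \<in> map_prod g g ` r"
      using \<open>g a = x\<close> \<open>g d = z\<close> by force
  qed
qed

text \<open>By reflexivity each of the three factors of \<open>r O s O r\<close> is contained in
  \<open>s O r O s\<close>, and transitivity absorbs the threefold composite of the latter.\<close>

lemma equiv_comp_le_if_trans:
  assumes "equiv B r" "equiv B s" "trans (s O r O s)"
  shows "r O s O r \<subseteq> s O r O s"
proof -
  have "r \<subseteq> s O r O s" "s \<subseteq> s O r O s"
    using assms(1,2) unfolding equiv_def refl_on_def by blast+
  then have "r O s O r \<subseteq> (s O r O s) O (s O r O s) O (s O r O s)"
    by (intro relcomp_mono)
  also have "\<dots> \<subseteq> s O r O s"
    using assms(3) by (metis relcomp_mono subset_refl subset_trans trans_O_subset)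
  finally show ?thesis .
qed

section \<open>Relations evaluated at an object\<close>

context category
begin

lemma relation_is_span: "is_relation C X Y R \<Longrightarrow> is_span C X Y R"
  by (auto simp: is_relation_def is_span_def is_product_def is_mono_def hom_def)

text \<open>Agreement on both legs is agreement after \<open>m\<close>, by uniqueness of arrows into
  the product, and \<open>m\<close> is mono.\<close>

lemma relation_jointly_mono:
  assumes R: "is_relation C X Y R"
    and "u \<in> hom C Z (Dom C (fst R))" "v \<in> hom C Z (Dom C (fst R))"
    and "fst R \<cdot> u = fst R \<cdot> v" "snd R \<cdot> u = snd R \<cdot> v"
  shows "u = v"
proof -
  obtain P p q m where P: "is_product C X Y P p q" and m: "is_mono C m" "Cod C m = P"
    and R_eq: "fst R = p \<cdot> m" "snd R = q \<cdot> m"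
    using R by (auto simp: is_relation_def)
  have pq: "p \<in> hom C P X" "q \<in> hom C P Y" and marr: "m \<in> Arr C"
    using P m by (auto simp: is_product_def is_mono_def)
  have uv: "u \<in> hom C Z (Dom C m)" "v \<in> hom C Z (Dom C m)"
    using assms(2,3) R_eq pq m marr by (auto simp: hom_def)
  have eq: "p \<cdot> (m \<cdot> u) = p \<cdot> (m \<cdot> v)" "q \<cdot> (m \<cdot> u) = q \<cdot> (m \<cdot> v)"
    using assms(4,5) R_eq pq m marr uv by (auto simp: hom_def)
  have "p \<cdot> (m \<cdot> u) \<in> hom C Z X" "q \<cdot> (m \<cdot> u) \<in> hom C Z Y"
    using pq m marr uv by (auto simp: hom_def)
  then have "\<exists>!h. h \<in> hom C Z P \<and> p \<cdot> h = p \<cdot> (m \<cdot> u) \<and> q \<cdot> h = q \<cdot> (m \<cdot> u)"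
    using P unfolding is_product_def by blast
  moreover have "m \<cdot> u \<in> hom C Z P" "m \<cdot> v \<in> hom C Z P"
    using m marr uv by (auto simp: hom_def)
  ultimately have "m \<cdot> u = m \<cdot> v"
    using eq by metis
  then show ?thesis
    using m(1) uv by (auto simp: is_mono_def)
qed

lemma rel_at_op: "is_span C X Y R \<Longrightarrow> rel_at C P (rel_op R) = (rel_at C P R)\<inverse>"
  by (auto simp: rel_at_def rel_op_def is_span_def)

lemma rel_at_id: "X \<in> Obj C \<Longrightarrow> rel_at C P (rel_id C X) = Id_on (hom C P X)"
  by (force simp: rel_at_def rel_id_def Comp_Ident_left)

lemma rel_at_subset_hom: "is_span C X Y R \<Longrightarrow> rel_at C P R \<subseteq> hom C P X \<times> hom C P Y"
  by (auto simp: rel_at_def is_span_def hom_def)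

lemma rel_at_mono:
  assumes "rel_le C R S" "is_span C X Y S"
  shows "rel_at C P R \<subseteq> rel_at C P S"
proof
  fix z assume "z \<in> rel_at C P R"
  then obtain k where k: "k \<in> hom C P (Dom C (fst R))" "z = (fst R \<cdot> k, snd R \<cdot> k)"
    by (auto simp: rel_at_def)
  obtain h where h: "h \<in> hom C (Dom C (fst R)) (Dom C (fst S))"
    "fst S \<cdot> h = fst R" "snd S \<cdot> h = snd R"
    using assms(1) by (auto simp: rel_le_def)
  have "(fst S \<cdot> h) \<cdot> k = fst S \<cdot> (h \<cdot> k)" "(snd S \<cdot> h) \<cdot> k = snd S \<cdot> (h \<cdot> k)"
    using k(1) h(1) assms(2) by (auto simp: is_span_def hom_def)
  then have "z = (fst S \<cdot> (h \<cdot> k), snd S \<cdot> (h \<cdot> k))"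
    using k(2) h(2,3) by simp
  moreover have "h \<cdot> k \<in> hom C P (Dom C (fst S))"
    using k h by (auto simp: hom_def)
  ultimately show "z \<in> rel_at C P S"
    by (auto simp: rel_at_def)
qed

end

section \<open>Projective covers\<close>

locale projective_covering = regular_category A for A :: "('o, 'm) cat" (structure) +
  fixes K :: "('o, 'm) cat"
  assumes cover: "projective_cover A K"
begin

lemma full: "full_subcategory K A"
  using cover by (simp add: projective_cover_def)

lemma K_category: "category K"
  using full by (simp add: full_subcategory_def)

lemma K_Obj: "X \<in> Obj K \<Longrightarrow> X \<in> Obj A"
  using full by (auto simp: full_subcategory_def)

lemma K_Ident: "X \<in> Obj K \<Longrightarrow> Ident K X = Ident A X"
  using full by (auto simp: full_subcategory_def)

lemma hom_K_iff: "f \<in> hom K X Y \<longleftrightarrow> X \<in> Obj K \<and> Y \<in> Obj K \<and> f \<in> hom A X Y"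
  using full by (auto simp: full_subcategory_def hom_def)

lemma arr_K_iff: "f \<in> Arr K \<longleftrightarrow> Dom A f \<in> Obj K \<and> Cod A f \<in> Obj K \<and> f \<in> Arr A"
  using full by (auto simp: full_subcategory_def)

lemma Dom_K [simp]: "f \<in> Arr K \<Longrightarrow> Dom K f = Dom A f"
  and Cod_K [simp]: "f \<in> Arr K \<Longrightarrow> Cod K f = Cod A f"
  using full by (auto simp: full_subcategory_def)

lemma comp_K [simp]:
  "f \<in> Arr K \<Longrightarrow> g \<in> Arr K \<Longrightarrow> Cod A f = Dom A g \<Longrightarrow> g \<cdot>\<^bsub>K\<^esub> f = g \<cdot> f"
  using full by (auto simp: full_subcategory_def)

lemma comp_K_hom: "f \<in> hom K X Y \<Longrightarrow> g \<in> hom K Y Z \<Longrightarrow> g \<cdot>\<^bsub>K\<^esub> f = g \<cdot> f"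
  by (auto simp: hom_def)

lemma projective_lift:
  assumes "P \<in> Obj K" "regular_epi A g" "g \<in> hom A Y X" "f \<in> hom A P X"
  obtains h where "h \<in> hom A P Y" "g \<cdot> h = f"
  using assms cover by (force simp: projective_cover_def regular_projective_def)

lemma cover_exists:
  assumes "X \<in> Obj A"
  obtains P e where "P \<in> Obj K" "e \<in> hom A P X" "regular_epi A e"
  using assms cover by (auto simp: projective_cover_def)

section \<open>Image factorization and regular images of spans\<close>

text \<open>Two elements \<open>u\<close>, \<open>v\<close> with
  \<open>m \<cdot> u = m \<cdot> v\<close> are restricted along a cover \<open>c\<close> of their
  domain by a projective object, and then lifted along \<open>e\<close> to \<open>a\<close> and
  \<open>b\<close>. Now \<open>f \<cdot> a = f \<cdot> b\<close>, so the pair factors through the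
  kernel pair of \<open>f\<close>, which \<open>e\<close> identifies. Hence \<open>u\<close> and
  \<open>v\<close> agree after \<open>c\<close>, and \<open>c\<close> can be cancelled.\<close>

lemma coequalizer_kernel_pair_mono:
  assumes pb: "is_pullback A f f p q" and e: "is_coequalizer A p q e"
    and m: "m \<in> hom A (Cod A e) (Cod A f)" "m \<cdot> e = f"
  shows "is_mono A m"
proof -
  have f: "f \<in> Arr A" "p \<in> Arr A" "q \<in> Arr A" "Cod A p = Dom A f" "Cod A q = Dom A f"
    "Dom A p = Dom A q"
    using pb by (auto simp: is_pullback_def commuting_square_def)
  have earr: "e \<in> Arr A" "Dom A e = Dom A f" "e \<cdot> p = e \<cdot> q"
    using e f by (auto simp: is_coequalizer_def)
  have reg: "regular_epi A e"
    using e by (auto simp: regular_epi_def)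
  have "u = v" if u: "u \<in> hom A Z (Cod A e)" and v: "v \<in> hom A Z (Cod A e)"
    and uv: "m \<cdot> u = m \<cdot> v" for Z u v
  proof -
    have "Z \<in> Obj A"
      using u Dom_Obj by (auto simp: hom_def)
    then obtain P c where P: "P \<in> Obj K" "c \<in> hom A P Z" "regular_epi A c"
      by (rule cover_exists)
    have "u \<cdot> c \<in> hom A P (Cod A e)" "v \<cdot> c \<in> hom A P (Cod A e)"
      using u v P by (auto simp: hom_def)
    moreover have "e \<in> hom A (Dom A f) (Cod A e)"
      using earr by (auto simp: hom_def)
    ultimately obtain a b where a: "a \<in> hom A P (Dom A f)" "e \<cdot> a = u \<cdot> c"
      and b: "b \<in> hom A P (Dom A f)" "e \<cdot> b = v \<cdot> c"
      using projective_lift[OF P(1) reg] by metis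
    have m_e: "f \<cdot> x = m \<cdot> (e \<cdot> x)" if "x \<in> hom A P (Dom A f)" for x
    proof -
      have "(m \<cdot> e) \<cdot> x = m \<cdot> (e \<cdot> x)"
        using m(1) earr that by (auto simp: hom_def)
      then show ?thesis
        using m(2) by simp
    qed
    have "f \<cdot> a = m \<cdot> (e \<cdot> a)"
      using m_e a(1) .
    also have "\<dots> = (m \<cdot> u) \<cdot> c"
      using m(1) u P a(2) by (auto simp: hom_def)
    also have "\<dots> = m \<cdot> (e \<cdot> b)"
      using m(1) v P b(2) uv by (auto simp: hom_def)
    also have "\<dots> = f \<cdot> b"
      using m_e[OF b(1)] by simp
    finally have "commuting_square A f f a b"
      using f a b by (auto simp: commuting_square_def hom_def)
    then obtain h where h: "h \<in> hom A (Dom A a) (Dom A p)" "p \<cdot> h = a" "q \<cdot> h = b"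
      using pb unfolding is_pullback_def by blast
    have "e \<cdot> a = (e \<cdot> p) \<cdot> h"
      using h(1,2) earr(1,2) f by (auto simp: hom_def)
    also have "\<dots> = e \<cdot> b"
      unfolding earr(3) using h(1,3) earr(1,2) f by (auto simp: hom_def)
    finally have "u \<cdot> c = v \<cdot> c"
      using a b by simp
    then show "u = v"
      using regular_epi_cancel[OF P(3)] u v P(2) by (auto simp: hom_def)
  qed
  then show ?thesis
    using m by (auto simp: is_mono_def hom_def)
qed

lemma image_exists:
  assumes f: "f \<in> hom A X Y"
  obtains I e m where "regular_epi A e" "e \<in> hom A X I" "is_mono A m" "m \<in> hom A I Y" "m \<cdot> e = f"
proof -
  obtain p q where pb: "is_pullback A f f p q"
    using pullback_exists[OF f f] .
  then obtain e where e: "is_coequalizer A p q e"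
    using kernel_pair_coequalizer by blast
  have pq: "Cod A p = X" "f \<cdot> p = f \<cdot> q" "f \<in> Arr A" "Dom A f = X" "Cod A f = Y"
    using pb f by (auto simp: is_pullback_def commuting_square_def hom_def)
  have "\<forall>h\<in>Arr A. Dom A h = Cod A p \<and> h \<cdot> p = h \<cdot> q \<longrightarrow>
      (\<exists>!k. k \<in> hom A (Cod A e) (Cod A h) \<and> k \<cdot> e = h)"
    using e by (simp add: is_coequalizer_def)
  from this[rule_format, OF pq(3)]
  have "\<exists>!k. k \<in> hom A (Cod A e) (Cod A f) \<and> k \<cdot> e = f"
    using pq by simp
  then obtain m where m: "m \<in> hom A (Cod A e) (Cod A f)" "m \<cdot> e = f"
    by blast
  show thesis
  proof
    show "regular_epi A e" "is_mono A m" "m \<cdot> e = f"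
      using e coequalizer_kernel_pair_mono[OF pb e m] m by (auto simp: regular_epi_def)
    show "e \<in> hom A X (Cod A e)" "m \<in> hom A (Cod A e) Y"
      using e m pq by (auto simp: is_coequalizer_def hom_def)
  qed
qed

text \<open>The two legs form one arrow into the product, and the mono part of its image
  factorization is the relation.\<close>

lemma relation_image_exists:
  assumes "is_span A X Y R"
  obtains T e where "is_relation A X Y T" "regular_epi A e" "e \<in> hom A (Dom A (fst R)) (Dom A (fst T))"
    "fst T \<cdot> e = fst R" "snd T \<cdot> e = snd R"
proof -
  have R: "fst R \<in> hom A (Dom A (fst R)) X" "snd R \<in> hom A (Dom A (fst R)) Y"
    using assms by (auto simp: is_span_def hom_def)
  have "X \<in> Obj A" "Y \<in> Obj A"
    using R Cod_Obj by (auto simp: hom_def)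
  then obtain P p q where P: "is_product A X Y P p q"
    by (rule product_exists)
  then obtain h where h: "h \<in> hom A (Dom A (fst R)) P" "p \<cdot> h = fst R" "q \<cdot> h = snd R"
    using R unfolding is_product_def by blast
  obtain I e m where e: "regular_epi A e" "e \<in> hom A (Dom A (fst R)) I" "is_mono A m"
    "m \<in> hom A I P" "m \<cdot> e = h"
    using image_exists[OF h(1)] .
  have pq: "p \<in> hom A P X" "q \<in> hom A P Y"
    using P by (auto simp: is_product_def)
  show thesis
  proof
    show "is_relation A X Y (p \<cdot> m, q \<cdot> m)"
      using P e by (auto simp: is_relation_def hom_def)
    show "regular_epi A e" "e \<in> hom A (Dom A (fst R)) (Dom A (fst (p \<cdot> m, q \<cdot> m)))"
      using e pq by (auto simp: hom_def)
    have "p \<cdot> (m \<cdot> e) = fst R" "q \<cdot> (m \<cdot> e) = snd R"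
      using e(5) h by auto
    then show "fst (p \<cdot> m, q \<cdot> m) \<cdot> e = fst R" "snd (p \<cdot> m, q \<cdot> m) \<cdot> e = snd R"
      using e(2,4) pq by (auto simp: hom_def)
  qed
qed

section \<open>Comparison of relations at the projective objects\<close>

text \<open>Projectivity of \<open>P\<close> lifts every element of \<open>T\<close> along
  \<open>e\<close> to an element of \<open>R\<close>. Thus \<open>rel_at\<close> does not
  distinguish a span from its regular image.\<close>

lemma rel_at_regular_image:
  assumes "P \<in> Obj K" "is_span A X Y T" "regular_epi A e" "e \<in> hom A (Dom A (fst R)) (Dom A (fst T))"
    and eq: "fst T \<cdot> e = fst R" "snd T \<cdot> e = snd R"
  shows "rel_at A P T = rel_at A P R"
proof
  have "rel_le A R T"
    using assms by (auto simp: rel_le_def)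
  then show "rel_at A P R \<subseteq> rel_at A P T"
    using assms(2) by (rule rel_at_mono)
  show "rel_at A P T \<subseteq> rel_at A P R"
  proof
    fix z assume "z \<in> rel_at A P T"
    then obtain k where k: "k \<in> hom A P (Dom A (fst T))" "z = (fst T \<cdot> k, snd T \<cdot> k)"
      by (auto simp: rel_at_def)
    obtain h where h: "h \<in> hom A P (Dom A (fst R))" "e \<cdot> h = k"
      using projective_lift[OF assms(1,3,4) k(1)] .
    have "(fst T \<cdot> e) \<cdot> h = fst T \<cdot> (e \<cdot> h)" "(snd T \<cdot> e) \<cdot> h = snd T \<cdot> (e \<cdot> h)"
      using h(1) assms(2,4) by (auto simp: is_span_def hom_def)
    then have "z = (fst R \<cdot> h, snd R \<cdot> h)"
      using k(2) h(2) eq by simp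
    then show "z \<in> rel_at A P R"
      using h by (auto simp: rel_at_def)
  qed
qed

text \<open>For the converse one test element suffices: a cover \<open>e\<close> of the apex of
  \<open>R\<close> is an element of \<open>R\<close>, hence of \<open>S\<close>, and so gives an
  arrow \<open>h\<close> into the apex of \<open>S\<close>. Joint monicity of \<open>S\<close> makes
  \<open>h\<close> descend along \<open>e\<close> to the required comparison
  \<open>k\<close>.\<close>

lemma rel_le_iff_rel_at:
  assumes R: "is_span A X Y R" and S: "is_relation A X Y S"
  shows "rel_le A R S \<longleftrightarrow> (\<forall>P\<in>Obj K. rel_at A P R \<subseteq> rel_at A P S)"
proof
  assume "rel_le A R S"
  then show "\<forall>P\<in>Obj K. rel_at A P R \<subseteq> rel_at A P S"
    using rel_at_mono[OF _ relation_is_span[OF S]] by blast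
next
  assume le: "\<forall>P\<in>Obj K. rel_at A P R \<subseteq> rel_at A P S"
  note S' = relation_is_span[OF S]
  have "Dom A (fst R) \<in> Obj A"
    using R Dom_Obj by (auto simp: is_span_def)
  then obtain P e where P: "P \<in> Obj K" "e \<in> hom A P (Dom A (fst R))" "regular_epi A e"
    by (rule cover_exists)
  then have "(fst R \<cdot> e, snd R \<cdot> e) \<in> rel_at A P S"
    using le by (auto simp: rel_at_def)
  then obtain h where h: "h \<in> hom A P (Dom A (fst S))" "fst S \<cdot> h = fst R \<cdot> e"
    "snd S \<cdot> h = snd R \<cdot> e"
    by (auto simp: rel_at_def)
  obtain u v where uv: "is_coequalizer A u v e"
    using P(3) by (auto simp: regular_epi_def)
  have uv': "u \<in> Arr A" "v \<in> Arr A" "Dom A u = Dom A v" "Cod A u = P" "Cod A v = P"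
    and ev: "e \<cdot> u = e \<cdot> v"
    using uv P(2) by (auto simp: is_coequalizer_def hom_def)
  \<comment> \<open>After either leg of \<open>S\<close>, \<open>h\<close> becomes the corresponding
    leg of \<open>R\<close> composed with \<open>e\<close>, and \<open>e\<close> identifies
    \<open>u\<close> and \<open>v\<close>.\<close>
  have sh: "fst S \<cdot> (h \<cdot> u) = fst S \<cdot> (h \<cdot> v) \<and> snd S \<cdot> (h \<cdot> u) = snd S \<cdot> (h \<cdot> v)"
  proof -
    have "fst S \<cdot> (h \<cdot> w) = fst R \<cdot> (e \<cdot> w) \<and> snd S \<cdot> (h \<cdot> w) = snd R \<cdot> (e \<cdot> w)"
      if "w \<in> Arr A" "Cod A w = P" for w
    proof -
      have "(fst S \<cdot> h) \<cdot> w = (fst R \<cdot> e) \<cdot> w" "(snd S \<cdot> h) \<cdot> w = (snd R \<cdot> e) \<cdot> w"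
        using h by simp_all
      then show ?thesis
        using h(1) S' R P(2) that by (auto simp: is_span_def hom_def)
    qed
    then show ?thesis
      using uv' ev by simp
  qed
  have "h \<cdot> u = h \<cdot> v"
    using relation_jointly_mono[OF S, of "h \<cdot> u" "Dom A u" "h \<cdot> v"] h(1) uv' sh
    by (auto simp: hom_def)
  moreover have "h \<in> Arr A" "Dom A h = Cod A u" "Cod A h = Dom A (fst S)"
    using h uv' by (auto simp: hom_def)
  ultimately obtain k where k: "k \<in> hom A (Cod A e) (Dom A (fst S))" "k \<cdot> e = h"
    using uv unfolding is_coequalizer_def by metis
  have k': "k \<in> hom A (Dom A (fst R)) (Dom A (fst S))"
    using k(1) P(2) by (auto simp: hom_def)
  have "(fst S \<cdot> k) \<cdot> e = fst R \<cdot> e" "(snd S \<cdot> k) \<cdot> e = snd R \<cdot> e"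
    using k' k(2) h(2,3) P(2) S' by (auto simp: hom_def is_span_def)
  then have "fst S \<cdot> k = fst R" "snd S \<cdot> k = snd R"
    using k' P(2) S' R regular_epi_cancel[OF P(3)] by (simp_all add: hom_def is_span_def)
  then show "rel_le A R S"
    using k' by (auto simp: rel_le_def)
qed

section \<open>Relational composites and equivalence relations\<close>

text \<open>An element of the pullback is the same as a pair of elements of \<open>R\<close> and
  \<open>S\<close> that match over \<open>Y\<close>; this matching value is the intermediate point
  of the set composite.\<close>

lemma rel_at_pullback:
  assumes R: "is_span A X Y R" and S: "is_span A Y Z S" and pb: "is_pullback A (snd R) (fst S) p q"
  shows "rel_at A P (fst R \<cdot> p, snd S \<cdot> q) = rel_at A P R O rel_at A P S"
proof
  have pq: "p \<in> Arr A" "q \<in> Arr A" "Dom A p = Dom A q" "Cod A p = Dom A (snd R)"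
    "Cod A q = Dom A (fst S)" "snd R \<cdot> p = fst S \<cdot> q"
    using pb by (auto simp: is_pullback_def commuting_square_def)
  note typing = R[unfolded is_span_def] S[unfolded is_span_def] hom_def
  show "rel_at A P (fst R \<cdot> p, snd S \<cdot> q) \<subseteq> rel_at A P R O rel_at A P S"
  proof
    fix z assume "z \<in> rel_at A P (fst R \<cdot> p, snd S \<cdot> q)"
    then obtain k where k: "k \<in> hom A P (Dom A p)"
      "z = (fst R \<cdot> (p \<cdot> k), snd S \<cdot> (q \<cdot> k))"
      using pq by (auto simp: rel_at_def typing)
    have "(snd R \<cdot> p) \<cdot> k = (fst S \<cdot> q) \<cdot> k"
      using pq by simp
    then have "snd R \<cdot> (p \<cdot> k) = fst S \<cdot> (q \<cdot> k)"
      using pq(1-5) k(1) by (auto simp: typing)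
    moreover have "p \<cdot> k \<in> hom A P (Dom A (fst R))" "q \<cdot> k \<in> hom A P (Dom A (fst S))"
      using pq k(1) by (auto simp: typing)
    ultimately have "(fst R \<cdot> (p \<cdot> k), snd R \<cdot> (p \<cdot> k)) \<in> rel_at A P R"
      "(snd R \<cdot> (p \<cdot> k), snd S \<cdot> (q \<cdot> k)) \<in> rel_at A P S"
      by (auto simp: rel_at_def)
    then show "z \<in> rel_at A P R O rel_at A P S"
      using k(2) by blast
  qed
  show "rel_at A P R O rel_at A P S \<subseteq> rel_at A P (fst R \<cdot> p, snd S \<cdot> q)"
  proof
    fix z assume "z \<in> rel_at A P R O rel_at A P S"
    then obtain a b where a: "a \<in> hom A P (Dom A (fst R))" and b: "b \<in> hom A P (Dom A (fst S))"
      and ab: "snd R \<cdot> a = fst S \<cdot> b" and z: "z = (fst R \<cdot> a, snd S \<cdot> b)"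
      by (auto simp: rel_at_def)
    have "commuting_square A (snd R) (fst S) a b"
      using a b ab by (auto simp: commuting_square_def typing)
    then obtain h where h: "h \<in> hom A (Dom A a) (Dom A p)" "p \<cdot> h = a" "q \<cdot> h = b"
      using pb unfolding is_pullback_def by blast
    have "z = ((fst R \<cdot> p) \<cdot> h, (snd S \<cdot> q) \<cdot> h)"
      using z h pq(1-5) a by (auto simp: typing)
    moreover have "h \<in> hom A P (Dom A (fst R \<cdot> p))"
      using h(1) a pq(1-5) by (auto simp: typing)
    ultimately show "z \<in> rel_at A P (fst R \<cdot> p, snd S \<cdot> q)"
      by (auto simp: rel_at_def)
  qed
qed

text \<open>This makes the choice in \<open>rel_comp\<close> meaningful: the pullback span has a
  regular image.\<close>

lemma rel_comp_exists:
  assumes R: "is_span A X Y R" and S: "is_span A Y Z S"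
  shows "is_rel_comp A S R (rel_comp A S R)"
proof -
  obtain p q where pb: "is_pullback A (snd R) (fst S) p q"
    using pullback_exists[of "snd R" _ Y "fst S"] R S by (auto simp: is_span_def hom_def)
  have "is_span A X Z (fst R \<cdot> p, snd S \<cdot> q)"
    using pb R S by (auto simp: is_pullback_def commuting_square_def is_span_def)
  then obtain T e where T: "is_relation A X Z T" "regular_epi A e"
    "e \<in> hom A (Dom A (fst R \<cdot> p)) (Dom A (fst T))"
    "fst T \<cdot> e = fst R \<cdot> p" "snd T \<cdot> e = snd S \<cdot> q"
    by (rule relation_image_exists) auto
  moreover have "Dom A (fst R \<cdot> p) = Dom A p" "Cod A (fst R) = X" "Cod A (snd S) = Z"
    using pb R S by (auto simp: is_pullback_def commuting_square_def is_span_def)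
  ultimately have "is_rel_comp A S R T"
    unfolding is_rel_comp_def using pb by metis
  then show ?thesis
    unfolding rel_comp_def by (rule someI)
qed

lemma rel_comp_relation:
  assumes "is_span A X Y R" "is_span A Y Z S"
  shows "is_relation A X Z (rel_comp A S R)"
  using rel_comp_exists[OF assms] assms by (auto simp: is_rel_comp_def is_span_def)

text \<open>The composite is the regular image of the pullback span, and the projective object
  \<open>P\<close> does not see the passage to the image. The factors change places because
  \<open>O\<close> lists the first relation on the left.\<close>

lemma rel_at_comp:
  assumes R: "is_span A X Y R" and S: "is_span A Y Z S" and P: "P \<in> Obj K"
  shows "rel_at A P (rel_comp A S R) = rel_at A P R O rel_at A P S"
proof -
  obtain p q e where pb: "is_pullback A (snd R) (fst S) p q" and e: "regular_epi A e"
    "e \<in> hom A (Dom A p) (Dom A (fst (rel_comp A S R)))"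
    "fst (rel_comp A S R) \<cdot> e = fst R \<cdot> p" "snd (rel_comp A S R) \<cdot> e = snd S \<cdot> q"
    using rel_comp_exists[OF R S] by (auto simp: is_rel_comp_def)
  have "Dom A (fst R \<cdot> p) = Dom A p"
    using pb R by (auto simp: is_pullback_def commuting_square_def is_span_def)
  then have "rel_at A P (rel_comp A S R) = rel_at A P (fst R \<cdot> p, snd S \<cdot> q)"
    using e by (intro rel_at_regular_image[OF P relation_is_span[OF rel_comp_relation[OF R S]] e(1)])
      auto
  then show ?thesis
    using rel_at_pullback[OF R S pb] by simp
qed

lemma rel_eq_iff_rel_at:
  assumes R: "is_relation A X Y R" and S: "is_relation A X Y S"
  shows "rel_eq A R S \<longleftrightarrow> (\<forall>P\<in>Obj K. rel_at A P R = rel_at A P S)"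
  unfolding rel_eq_def rel_le_iff_rel_at[OF relation_is_span[OF R] S]
    rel_le_iff_rel_at[OF relation_is_span[OF S] R]
  by blast

lemma equivalence_relation_iff_rel_at:
  assumes R: "is_relation A X X R"
  shows "equivalence_relation A X R \<longleftrightarrow> (\<forall>P\<in>Obj K. equiv (hom A P X) (rel_at A P R))"
proof -
  note R' = relation_is_span[OF R]
  have X: "X \<in> Obj A"
    using R' Cod_Obj by (auto simp: is_span_def)
  have spans: "is_span A X X (rel_id A X)" "is_span A X X (rel_op R)"
    "is_span A X X (rel_comp A R R)"
    using X R' relation_is_span[OF rel_comp_relation[OF R' R']]
    by (auto simp: is_span_def rel_id_def rel_op_def)
  show ?thesis
    unfolding equivalence_relation_def rel_le_iff_rel_at[OF spans(1) R]
      rel_le_iff_rel_at[OF spans(2) R] rel_le_iff_rel_at[OF spans(3) R]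
      equiv_iff_subset[OF rel_at_subset_hom[OF R']]
    using R by (simp add: rel_at_id[OF X] rel_at_op[OF R'] rel_at_comp[OF R' R'] ball_conj_distrib)
qed

lemma equiv_rel_at:
  assumes "equivalence_relation A X R" "P \<in> Obj K"
  shows "equiv (hom A P X) (rel_at A P R)"
proof -
  have "is_relation A X X R"
    using assms(1) by (simp add: equivalence_relation_def)
  then show ?thesis
    using assms equivalence_relation_iff_rel_at by simp
qed

section \<open>Pseudo-equivalence relations at the projective objects\<close>

text \<open>Two composable elements \<open>a\<close>, \<open>b\<close> at \<open>P\<close> form a
  commuting square in \<open>K\<close>, so they factor through the weak pullback by some
  \<open>h\<close>; then \<open>t \<cdot> h\<close> witnesses the composite pair.\<close>

lemma pseudo_transitiveD:
  assumes t: "pseudo_transitive K r1 r2"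
    and r: "r1 \<in> hom K R X" "r2 \<in> hom K R X" and P: "P \<in> Obj K"
  shows "trans (rel_at A P (r1, r2))"
proof (rule transI)
  fix x y z assume xy: "(x, y) \<in> rel_at A P (r1, r2)" and yz: "(y, z) \<in> rel_at A P (r1, r2)"
  have r': "r1 \<in> Arr K" "r2 \<in> Arr K" "r1 \<in> Arr A" "r2 \<in> Arr A" "Dom A r1 = R" "Dom A r2 = R"
    "Cod A r1 = X" "Cod A r2 = X" "R \<in> Obj K" "X \<in> Obj K"
    using r hom_K_iff arr_K_iff by (auto simp: hom_def)
  obtain p1 p2 t where w: "is_weak_pullback K r2 r1 p1 p2" and t: "t \<in> hom K (Dom K p1) (Dom K r1)"
    and rt: "r1 \<cdot>\<^bsub>K\<^esub> t = r1 \<cdot>\<^bsub>K\<^esub> p1" "r2 \<cdot>\<^bsub>K\<^esub> t = r2 \<cdot>\<^bsub>K\<^esub> p2"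
    using t by (auto simp: pseudo_transitive_def)
  have p: "p1 \<in> Arr K" "p2 \<in> Arr K" "Dom A p1 = Dom A p2" "Cod A p1 = R" "Cod A p2 = R"
    using w r' by (auto simp: is_weak_pullback_def commuting_square_def)
  have pA: "p1 \<in> Arr A" "p2 \<in> Arr A"
    using p arr_K_iff by auto
  have t': "t \<in> Arr K" "t \<in> Arr A" "Dom A t = Dom A p1" "Cod A t = R"
    using t p r' hom_K_iff arr_K_iff by (auto simp: hom_def)
  have rt': "r1 \<cdot> t = r1 \<cdot> p1" "r2 \<cdot> t = r2 \<cdot> p2"
    using rt p r' t' by auto
  obtain a where a: "a \<in> hom A P R" "x = r1 \<cdot> a" "y = r2 \<cdot> a"
    using xy r' by (auto simp: rel_at_def)
  obtain b where b: "b \<in> hom A P R" "y = r1 \<cdot> b" "z = r2 \<cdot> b"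
    using yz r' by (auto simp: rel_at_def)
  have ab: "a \<in> Arr K" "b \<in> Arr K" "Dom A a = P" "Dom A b = P" "Cod A a = R" "Cod A b = R"
    using a b P r' by (auto simp: arr_K_iff hom_def)
  then have "commuting_square K r2 r1 a b"
    using a b r' by (auto simp: commuting_square_def)
  then obtain h where h: "h \<in> hom K (Dom K a) (Dom K p1)" "p1 \<cdot>\<^bsub>K\<^esub> h = a" "p2 \<cdot>\<^bsub>K\<^esub> h = b"
    using w unfolding is_weak_pullback_def by blast
  have h': "h \<in> Arr K" "h \<in> Arr A" "Dom A h = P" "Cod A h = Dom A p1"
    using h ab p hom_K_iff arr_K_iff by (auto simp: hom_def)
  have ph: "p1 \<cdot> h = a" "p2 \<cdot> h = b"
    using h(2,3) h' p by auto
  have "(r1 \<cdot> t) \<cdot> h = x" "(r2 \<cdot> t) \<cdot> h = z"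
    unfolding rt' using pA r' h' p a b ph by auto
  then have "x = r1 \<cdot> (t \<cdot> h)" "z = r2 \<cdot> (t \<cdot> h)"
    using t' r' h' by auto
  moreover have "t \<cdot> h \<in> hom A P R"
    using t' h' by (auto simp: hom_def)
  ultimately show "(x, z) \<in> rel_at A P (r1, r2)"
    using r' by (auto simp: rel_at_def)
qed

text \<open>A weak pullback in \<open>K\<close> is obtained by covering the pullback taken in
  \<open>A\<close>: a commuting square in \<open>K\<close> factors through the pullback, and the
  factorization lifts along the cover \<open>e\<close> by projectivity.\<close>

lemma pseudo_transitiveI:
  assumes r: "r1 \<in> hom K R X" "r2 \<in> hom K R X"
    and trans: "\<And>P. P \<in> Obj K \<Longrightarrow> trans (rel_at A P (r1, r2))"
  shows "pseudo_transitive K r1 r2"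
proof -
  have r': "r1 \<in> Arr K" "r2 \<in> Arr K" "r1 \<in> Arr A" "r2 \<in> Arr A" "Dom A r1 = R" "Dom A r2 = R"
    "Cod A r1 = X" "Cod A r2 = X" "R \<in> Obj K" "X \<in> Obj K"
    using r hom_K_iff arr_K_iff by (auto simp: hom_def)
  obtain p q where pb: "is_pullback A r2 r1 p q"
    using pullback_exists[of r2 R X r1 R] r' by (auto simp: hom_def)
  have pq: "p \<in> Arr A" "q \<in> Arr A" "Dom A p = Dom A q" "Cod A p = R" "Cod A q = R"
    "r2 \<cdot> p = r1 \<cdot> q"
    using pb r' by (auto simp: is_pullback_def commuting_square_def)
  obtain W e where W: "W \<in> Obj K" "e \<in> hom A W (Dom A p)" "regular_epi A e"
    using cover_exists[OF Dom_Obj[OF pq(1)]] .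
  have e: "e \<in> Arr A" "Dom A e = W" "Cod A e = Dom A p"
    using W by (auto simp: hom_def)
  have pe: "p \<cdot> e \<in> Arr K" "q \<cdot> e \<in> Arr K"
    using e pq r' W by (auto simp: arr_K_iff)
  have "(r2 \<cdot> p) \<cdot> e = (r1 \<cdot> q) \<cdot> e"
    using pq by simp
  then have comm: "r2 \<cdot> (p \<cdot> e) = r1 \<cdot> (q \<cdot> e)"
    using pq(1-5) e r' by auto
  have wp: "is_weak_pullback K r2 r1 (p \<cdot> e) (q \<cdot> e)"
    unfolding is_weak_pullback_def
  proof (intro conjI allI impI)
    show "commuting_square K r2 r1 (p \<cdot> e) (q \<cdot> e)"
      using pe r' pq(1-5) e comm by (auto simp: commuting_square_def)
    fix u v assume uv: "commuting_square K r2 r1 u v"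
    have u: "u \<in> Arr K" "v \<in> Arr K" "Dom A u = Dom A v" "Cod A u = R" "Cod A v = R"
      using uv r' by (auto simp: commuting_square_def)
    have "r2 \<cdot> u = r1 \<cdot> v"
      using uv r' by (auto simp: commuting_square_def)
    then have "commuting_square A r2 r1 u v"
      using u r' arr_K_iff by (auto simp: commuting_square_def)
    then obtain h where h: "h \<in> hom A (Dom A u) (Dom A p)" "p \<cdot> h = u" "q \<cdot> h = v"
      using pb unfolding is_pullback_def by blast
    have U: "Dom A u \<in> Obj K"
      using u arr_K_iff by auto
    obtain k where k: "k \<in> hom A (Dom A u) W" "e \<cdot> k = h"
      using projective_lift[OF U W(3,2) h(1)] .
    have kK: "k \<in> Arr K"
      using k U W by (auto simp: arr_K_iff hom_def)
    have "(p \<cdot> e) \<cdot> k = u" "(q \<cdot> e) \<cdot> k = v"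
      using h(2,3) k pq(1-5) e by (auto simp: hom_def)
    then show "\<exists>h. h \<in> hom K (Dom K u) (Dom K (p \<cdot> e)) \<and> (p \<cdot> e) \<cdot>\<^bsub>K\<^esub> h = u \<and>
        (q \<cdot> e) \<cdot>\<^bsub>K\<^esub> h = v"
      using kK k(1) pe u pq(1-5) e
      by (intro exI[of _ k]) (auto simp: hom_def)
  qed
  \<comment> \<open>The two projections from \<open>W\<close> are the generic composable pair, so
    transitivity at the single object \<open>W\<close> already yields \<open>t\<close>.\<close>
  have "(r1 \<cdot> (p \<cdot> e), r2 \<cdot> (p \<cdot> e)) \<in> rel_at A W (r1, r2)"
    "(r2 \<cdot> (p \<cdot> e), r2 \<cdot> (q \<cdot> e)) \<in> rel_at A W (r1, r2)"
    using r' pq(1-5) e comm by (auto simp: rel_at_def hom_def)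
  then have "(r1 \<cdot> (p \<cdot> e), r2 \<cdot> (q \<cdot> e)) \<in> rel_at A W (r1, r2)"
    using trans[OF W(1)] by (blast dest: transD)
  then obtain t where t: "t \<in> hom A W R" "r1 \<cdot> (p \<cdot> e) = r1 \<cdot> t" "r2 \<cdot> (q \<cdot> e) = r2 \<cdot> t"
    using r' by (auto simp: rel_at_def)
  have tK: "t \<in> Arr K"
    using t W r' by (auto simp: arr_K_iff hom_def)
  show ?thesis
    unfolding pseudo_transitive_def
  proof (intro exI conjI)
    show "is_weak_pullback K r2 r1 (p \<cdot> e) (q \<cdot> e)"
      by (rule wp)
    show "t \<in> hom K (Dom K (p \<cdot> e)) (Dom K r1)" "r1 \<cdot>\<^bsub>K\<^esub> t = r1 \<cdot>\<^bsub>K\<^esub> (p \<cdot> e)"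
      "r2 \<cdot>\<^bsub>K\<^esub> t = r2 \<cdot>\<^bsub>K\<^esub> (q \<cdot> e)"
      using t tK pe r' pq(1-5) e by (auto simp: hom_def)
  qed
qed

text \<open>From left to right, the structure arrows act on elements by composition. From right to
  left, they are recovered from generic elements: reflexivity from the pair of identities at
  \<open>X\<close>, and symmetry from \<open>(r1, r2)\<close>, which is an element of itself at its
  own domain \<open>R\<close>.\<close>

lemma pseudo_equivalence_relation_iff_rel_at:
  assumes r: "r1 \<in> hom K R X" "r2 \<in> hom K R X"
  shows "pseudo_equivalence_relation K X r1 r2 \<longleftrightarrow>
    (\<forall>P\<in>Obj K. equiv (hom A P X) (rel_at A P (r1, r2)))"
proof -
  have r': "r1 \<in> Arr K" "r2 \<in> Arr K" "r1 \<in> Arr A" "r2 \<in> Arr A" "Dom A r1 = R" "Dom A r2 = R"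
    "Cod A r1 = X" "Cod A r2 = X" "R \<in> Obj K" "X \<in> Obj K"
    using r hom_K_iff arr_K_iff by (auto simp: hom_def)
  have X: "X \<in> Obj A" "R \<in> Obj A"
    using r' K_Obj by auto
  have span: "is_span A X X (r1, r2)"
    using r' by (auto simp: is_span_def)
  have rel: "pseudo_relation K X r1 r2"
    using r by (auto simp: pseudo_relation_def)
  show ?thesis
  proof
    assume eq: "pseudo_equivalence_relation K X r1 r2"
    show "\<forall>P\<in>Obj K. equiv (hom A P X) (rel_at A P (r1, r2))"
    proof
      fix P assume P: "P \<in> Obj K"
      show "equiv (hom A P X) (rel_at A P (r1, r2))"
      proof (rule equivI)
        show "rel_at A P (r1, r2) \<subseteq> hom A P X \<times> hom A P X"
          using rel_at_subset_hom[OF span] .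
        show "trans (rel_at A P (r1, r2))"
          using eq pseudo_transitiveD[OF _ r P] by (auto simp: pseudo_equivalence_relation_def)
        obtain s where s: "s \<in> hom K X R" "r1 \<cdot>\<^bsub>K\<^esub> s = Ident K X" "r2 \<cdot>\<^bsub>K\<^esub> s = Ident K X"
          using eq r' by (auto simp: pseudo_equivalence_relation_def pseudo_reflexive_def)
        have s': "s \<in> hom A X R" "r1 \<cdot> s = Ident A X" "r2 \<cdot> s = Ident A X"
          using s hom_K_iff comp_K_hom[OF s(1) r(1)] comp_K_hom[OF s(1) r(2)] K_Ident r' by auto
        have "(x, x) \<in> rel_at A P (r1, r2)" if x: "x \<in> hom A P X" for x
        proof -
          have "r1 \<cdot> (s \<cdot> x) = (r1 \<cdot> s) \<cdot> x" "r2 \<cdot> (s \<cdot> x) = (r2 \<cdot> s) \<cdot> x"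
            using s'(1) x r' by (auto simp: hom_def)
          then have "r1 \<cdot> (s \<cdot> x) = x" "r2 \<cdot> (s \<cdot> x) = x"
            unfolding s' using Comp_Ident_left x by auto
          moreover have "s \<cdot> x \<in> hom A P R"
            using s'(1) x by (auto simp: hom_def)
          ultimately show ?thesis
            using r' by (force simp: rel_at_def)
        qed
        then show "refl_on (hom A P X) (rel_at A P (r1, r2))"
          by (auto simp: refl_on_def)
        obtain s where s: "s \<in> hom K R R" "r2 = r1 \<cdot>\<^bsub>K\<^esub> s" "r1 = r2 \<cdot>\<^bsub>K\<^esub> s"
          using eq r' by (auto simp: pseudo_equivalence_relation_def pseudo_symmetric_def)
        have s': "s \<in> hom A R R" "r1 \<cdot> s = r2" "r2 \<cdot> s = r1"
          using s hom_K_iff comp_K_hom[OF s(1) r(1)] comp_K_hom[OF s(1) r(2)] by auto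
        show "sym (rel_at A P (r1, r2))"
        proof (rule symI)
          fix x y assume "(x, y) \<in> rel_at A P (r1, r2)"
          then obtain k where k: "k \<in> hom A P R" "x = r1 \<cdot> k" "y = r2 \<cdot> k"
            using r' by (auto simp: rel_at_def)
          have "(r1 \<cdot> s) \<cdot> k = y" "(r2 \<cdot> s) \<cdot> k = x"
            using s' k by auto
          then have "r1 \<cdot> (s \<cdot> k) = y" "r2 \<cdot> (s \<cdot> k) = x"
            using s'(1) k(1) r' by (auto simp: hom_def)
          moreover have "s \<cdot> k \<in> hom A P R"
            using s'(1) k(1) by (auto simp: hom_def)
          ultimately show "(y, x) \<in> rel_at A P (r1, r2)"
            using r' by (force simp: rel_at_def)
        qed
      qed
    qed
  next
    assume eq: "\<forall>P\<in>Obj K. equiv (hom A P X) (rel_at A P (r1, r2))"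
    have "pseudo_transitive K r1 r2"
      using eq by (intro pseudo_transitiveI[OF r]) (auto simp: equiv_def)
    moreover have "pseudo_reflexive K X r1 r2"
    proof -
      have "(Ident A X, Ident A X) \<in> rel_at A X (r1, r2)"
        using eq r' Ident_hom[OF X(1)] by (auto simp: equiv_def refl_on_def)
      then obtain s where s: "s \<in> hom A X R" "r1 \<cdot> s = Ident A X" "r2 \<cdot> s = Ident A X"
        using r' by (auto simp: rel_at_def)
      then have sK: "s \<in> hom K X R"
        using r' hom_K_iff by auto
      show ?thesis
        unfolding pseudo_reflexive_def
        using s sK comp_K_hom[OF sK r(1)] comp_K_hom[OF sK r(2)] K_Ident r' by auto
    qed
    moreover have "pseudo_symmetric K r1 r2"
    proof -
      have "(r1, r2) \<in> rel_at A R (r1, r2)"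
        using r' X(2) Ident_hom[OF X(2)] comp_ident[OF r'(3)] comp_ident[OF r'(4)]
        by (force simp: rel_at_def)
      then have "(r2, r1) \<in> rel_at A R (r1, r2)"
        using eq r' by (auto simp: equiv_def sym_def)
      then obtain s where s: "s \<in> hom A R R" "r1 \<cdot> s = r2" "r2 \<cdot> s = r1"
        using r' by (auto simp: rel_at_def)
      then have sK: "s \<in> hom K R R"
        using r' hom_K_iff by auto
      show ?thesis
        unfolding pseudo_symmetric_def
        using s sK comp_K_hom[OF sK r(1)] comp_K_hom[OF sK r(2)] r' by auto
    qed
    ultimately show "pseudo_equivalence_relation K X r1 r2"
      using rel by (auto simp: pseudo_equivalence_relation_def)
  qed
qed

section \<open>Weak finite limits in the cover\<close>

text \<open>A cover \<open>W\<close> of the limit in \<open>A\<close> is a weak limit in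
  \<open>K\<close>: cones factor through the limit and then lift along \<open>e\<close>. The lift
  involves a choice, so uniqueness of the factorization is lost.\<close>

lemma weakly_lex_cover: "weakly_lex K"
  unfolding weakly_lex_def
proof (intro conjI allI impI)
  show "category K" by (rule K_category)
  fix J :: "(nat, nat) cat" and FO FA
  assume F: "is_functor J K FO FA \<and> finite (Obj J) \<and> finite (Arr J)"
  then have J: "category J" and FO: "\<And>j. j \<in> Obj J \<Longrightarrow> FO j \<in> Obj K"
    and FA: "\<And>a. a \<in> Arr J \<Longrightarrow> FA a \<in> hom K (FO (Dom J a)) (FO (Cod J a))"
    by (auto simp: is_functor_def)
  interpret J: category J by (rule J)
  have comp: "FA (b \<cdot>\<^bsub>J\<^esub> a) = FA b \<cdot> FA a"
    if "a \<in> Arr J" "b \<in> Arr J" "Dom J b = Cod J a" for a b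
    using F that comp_K_hom[OF FA[OF that(1)], of "FA b"] FA[OF that(2)]
    by (auto simp: is_functor_def)
  have "is_functor J A FO FA"
    using F J FO FA comp K_Obj K_Ident category_axioms hom_K_iff by (simp add: is_functor_def)
  then obtain L l where L: "is_limit J A FO FA L l"
    using finite_limits F unfolding has_finite_limits_def by blast
  then have l: "L \<in> Obj A" "\<And>j. j \<in> Obj J \<Longrightarrow> l j \<in> hom A L (FO j)"
    "\<And>a. a \<in> Arr J \<Longrightarrow> FA a \<cdot> l (Dom J a) = l (Cod J a)"
    by (auto simp: is_limit_def is_cone_def)
  obtain W e where W: "W \<in> Obj K" "e \<in> hom A W L" "regular_epi A e"
    using cover_exists[OF l(1)] .
  have le: "l j \<cdot> e \<in> hom K W (FO j)" if "j \<in> Obj J" for j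
    using l(2)[OF that] W FO[OF that] unfolding hom_K_iff by (auto simp: hom_def)
  have "is_weak_limit J K FO FA W (\<lambda>j. l j \<cdot> e)"
    unfolding is_weak_limit_def
  proof (intro conjI allI impI)
    have "FA a \<cdot>\<^bsub>K\<^esub> (l (Dom J a) \<cdot> e) = l (Cod J a) \<cdot> e" if a: "a \<in> Arr J" for a
    proof -
      have "FA a \<cdot>\<^bsub>K\<^esub> (l (Dom J a) \<cdot> e) = FA a \<cdot> (l (Dom J a) \<cdot> e)"
        using comp_K_hom[OF le FA[OF a]] J.Dom_Obj[OF a] by auto
      also have "\<dots> = (FA a \<cdot> l (Dom J a)) \<cdot> e"
        using l(2)[OF J.Dom_Obj[OF a]] FA[OF a] W(2) unfolding hom_K_iff by (auto simp: hom_def)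
      finally show ?thesis
        using l(3)[OF a] by simp
    qed
    then show "is_cone J K FO FA W (\<lambda>j. l j \<cdot> e)"
      using W le by (auto simp: is_cone_def)
    fix M m assume M: "is_cone J K FO FA M m"
    then have MK: "M \<in> Obj K" and m: "\<And>j. j \<in> Obj J \<Longrightarrow> m j \<in> hom K M (FO j)"
      by (auto simp: is_cone_def)
    have "FA a \<cdot> m (Dom J a) = m (Cod J a)" if a: "a \<in> Arr J" for a
      using M a comp_K_hom[OF m FA[OF a]] J.Dom_Obj[OF a] by (auto simp: is_cone_def)
    then have "is_cone J A FO FA M m"
      using m MK K_Obj hom_K_iff by (auto simp: is_cone_def)
    then obtain h where h: "h \<in> hom A M L" "\<And>j. j \<in> Obj J \<Longrightarrow> l j \<cdot> h = m j"
      using L unfolding is_limit_def by blast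
    obtain k where k: "k \<in> hom A M W" "e \<cdot> k = h"
      using projective_lift[OF MK W(3,2) h(1)] .
    have kK: "k \<in> hom K M W"
      using k MK W by (auto simp: hom_K_iff)
    have "(l j \<cdot> e) \<cdot>\<^bsub>K\<^esub> k = m j" if j: "j \<in> Obj J" for j
    proof -
      have "(l j \<cdot> e) \<cdot>\<^bsub>K\<^esub> k = (l j \<cdot> e) \<cdot> k"
        using comp_K_hom[OF kK le[OF j]] by simp
      also have "\<dots> = l j \<cdot> (e \<cdot> k)"
        using l(2)[OF j] W(2) k(1) by (auto simp: hom_def)
      finally show ?thesis
        using h(2)[OF j] k(2) by simp
    qed
    then show "\<exists>h. h \<in> hom K M W \<and> (\<forall>j\<in>Obj J. (l j \<cdot> e) \<cdot>\<^bsub>K\<^esub> h = m j)"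
      using kK by blast
  qed
  then show "\<exists>L l. is_weak_limit J K FO FA L l"
    by blast
qed

section \<open>Graphs, inverse images and direct images\<close>

lemma rel_at_graph:
  assumes "f \<in> hom A X Y"
  shows "rel_at A P (Ident A X, f) = {(x, f \<cdot> x) | x. x \<in> hom A P X}"
proof -
  have "X \<in> Obj A"
    using assms Dom_Obj by (auto simp: hom_def)
  then show ?thesis
    by (auto simp: rel_at_def Comp_Ident_left) (metis Comp_Ident_left)
qed

text \<open>The relation is the composite of the graph of \<open>f\<close>, then \<open>R\<close>,
  then the opposite graph. Taking \<open>rel_id\<close> for \<open>R\<close> gives the kernel pair
  of \<open>f\<close>.\<close>

lemma inverse_image_relation:
  assumes f: "f \<in> hom A X Y" and R: "is_span A Y Y R"
  obtains T where "is_relation A X X T"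
    "\<forall>P\<in>Obj K. rel_at A P T =
      {(x, y). x \<in> hom A P X \<and> y \<in> hom A P X \<and> (f \<cdot> x, f \<cdot> y) \<in> rel_at A P R}"
proof
  let ?G = "(Ident A X, f)"
  have "X \<in> Obj A"
    using f Dom_Obj by (auto simp: hom_def)
  then have G: "is_span A X Y ?G" and G': "is_span A Y X (rel_op ?G)"
    using f by (auto simp: is_span_def rel_op_def hom_def)
  note RG = relation_is_span[OF rel_comp_relation[OF G R]]
  show "is_relation A X X (rel_comp A (rel_op ?G) (rel_comp A R ?G))"
    by (rule rel_comp_relation[OF RG G'])
  have "rel_at A P (rel_comp A (rel_op ?G) (rel_comp A R ?G)) =
      {(x, y). x \<in> hom A P X \<and> y \<in> hom A P X \<and> (f \<cdot> x, f \<cdot> y) \<in> rel_at A P R}"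
    if P: "P \<in> Obj K" for P
    unfolding rel_at_comp[OF RG G' P] rel_at_comp[OF G R P] rel_at_op[OF G] rel_at_graph[OF f]
    by blast
  then show "\<forall>P\<in>Obj K. rel_at A P (rel_comp A (rel_op ?G) (rel_comp A R ?G)) =
      {(x, y). x \<in> hom A P X \<and> y \<in> hom A P X \<and> (f \<cdot> x, f \<cdot> y) \<in> rel_at A P R}"
    by blast
qed

text \<open>The apex of the inverse image need not lie in \<open>K\<close>. Covering it by an object
  of \<open>K\<close> gives a pseudo-relation there with the same elements.\<close>

lemma inverse_image_exists:
  assumes f: "f \<in> hom A X Y" and X: "X \<in> Obj K" and R: "is_span A Y Y R"
  obtains Q q1 q2 where "q1 \<in> hom K Q X" "q2 \<in> hom K Q X"
    "\<forall>P\<in>Obj K. rel_at A P (q1, q2) =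
      {(x, y). x \<in> hom A P X \<and> y \<in> hom A P X \<and> (f \<cdot> x, f \<cdot> y) \<in> rel_at A P R}"
proof -
  obtain T where T: "is_relation A X X T" and rel: "\<forall>P\<in>Obj K. rel_at A P T =
      {(x, y). x \<in> hom A P X \<and> y \<in> hom A P X \<and> (f \<cdot> x, f \<cdot> y) \<in> rel_at A P R}"
    by (rule inverse_image_relation[OF f R])
  note T' = relation_is_span[OF T]
  have "Dom A (fst T) \<in> Obj A"
    using T' Dom_Obj by (auto simp: is_span_def)
  then obtain Q e where Q: "Q \<in> Obj K" "e \<in> hom A Q (Dom A (fst T))" "regular_epi A e"
    by (rule cover_exists)
  show thesis
  proof
    show "fst T \<cdot> e \<in> hom K Q X" "snd T \<cdot> e \<in> hom K Q X"
      using T' Q X unfolding hom_K_iff by (auto simp: is_span_def hom_def)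
    have "rel_at A P T = rel_at A P (fst T \<cdot> e, snd T \<cdot> e)" if P: "P \<in> Obj K" for P
      using Q T' by (intro rel_at_regular_image[OF P T' Q(3)]) (auto simp: is_span_def hom_def)
    then show "\<forall>P\<in>Obj K. rel_at A P (fst T \<cdot> e, snd T \<cdot> e) =
        {(x, y). x \<in> hom A P X \<and> y \<in> hom A P X \<and> (f \<cdot> x, f \<cdot> y) \<in> rel_at A P R}"
      using rel by simp
  qed
qed

lemma rel_at_direct_image:
  assumes "is_span A X X (r1, r2)" "f \<in> hom A X Y"
  shows "rel_at A P (f \<cdot> r1, f \<cdot> r2) = map_prod ((\<cdot>) f) ((\<cdot>) f) ` rel_at A P (r1, r2)"
  using assms by (force simp: rel_at_def is_span_def hom_def)

section \<open>The two implications\<close>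

text \<open>Both sides of the Goursat identity are palindromes, so the reversal of factors in
  \<open>rel_at_comp\<close> leaves its form unchanged.\<close>

lemma goursat_iff_rel_at:
  "goursat_category A \<longleftrightarrow>
    (\<forall>X\<in>Obj A. \<forall>R S. equivalence_relation A X R \<and> equivalence_relation A X S \<longrightarrow>
      (\<forall>P\<in>Obj K. rel_at A P R O rel_at A P S O rel_at A P R =
        rel_at A P S O rel_at A P R O rel_at A P S))"
proof -
  have "rel_eq A (rel_comp A R (rel_comp A S R)) (rel_comp A S (rel_comp A R S)) \<longleftrightarrow>
      (\<forall>P\<in>Obj K. rel_at A P R O rel_at A P S O rel_at A P R =
        rel_at A P S O rel_at A P R O rel_at A P S)"
    if "equivalence_relation A X R" "equivalence_relation A X S" for X R S
  proof -
    have R: "is_span A X X R" and S: "is_span A X X S"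
      using that relation_is_span by (auto simp: equivalence_relation_def)
    note RS = relation_is_span[OF rel_comp_relation[OF R S]]
      and SR = relation_is_span[OF rel_comp_relation[OF S R]]
    show ?thesis
      unfolding rel_eq_iff_rel_at[OF rel_comp_relation[OF RS R] rel_comp_relation[OF SR S]]
      by (simp add: rel_at_comp[OF RS R] rel_at_comp[OF SR S] rel_at_comp[OF R S]
          rel_at_comp[OF S R] O_assoc)
  qed
  then show ?thesis
    unfolding goursat_category_def using regular_category_axioms by blast
qed

lemma goursat_imp_weak_goursat:
  assumes "goursat_category A"
  shows "weak_goursat_category A K"
  unfolding weak_goursat_category_def
proof (intro conjI allI impI)
  show "weakly_lex K"
    by (rule weakly_lex_cover)
  fix X Y r1 r2 f
  assume "pseudo_equivalence_relation K X r1 r2 \<and> f \<in> hom K X Y \<and> regular_epi A f"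
  then have eq: "pseudo_equivalence_relation K X r1 r2" and fK: "f \<in> hom K X Y"
    and f: "f \<in> hom A X Y" "regular_epi A f" and XY: "X \<in> Obj K" "Y \<in> Obj K"
    by (auto simp: hom_K_iff)
  obtain R where r: "r1 \<in> hom K R X" "r2 \<in> hom K R X"
    using eq by (auto simp: pseudo_equivalence_relation_def pseudo_relation_def)
  then have span: "is_span A X X (r1, r2)"
    unfolding hom_K_iff by (auto simp: is_span_def hom_def)
  have equiv: "equiv (hom A P X) (rel_at A P (r1, r2))" if "P \<in> Obj K" for P
    using eq that pseudo_equivalence_relation_iff_rel_at[OF r] by blast
  \<comment> \<open>The Goursat identity speaks of relations, so the pseudo-relation is replaced by
    its regular image \<open>T\<close>, which has the same elements at every object of
    \<open>K\<close>.\<close>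
  obtain T e where T: "is_relation A X X T" and e: "regular_epi A e"
    "e \<in> hom A (Dom A (fst (r1, r2))) (Dom A (fst T))"
    "fst T \<cdot> e = fst (r1, r2)" "snd T \<cdot> e = snd (r1, r2)"
    using relation_image_exists[OF span] by blast
  have relT: "rel_at A P T = rel_at A P (r1, r2)" if "P \<in> Obj K" for P
    using rel_at_regular_image[OF that relation_is_span[OF T] e] .
  have eqT: "equivalence_relation A X T"
    using equiv by (simp add: equivalence_relation_iff_rel_at[OF T] relT)
  have Y: "Y \<in> Obj A" "X \<in> Obj A"
    using XY K_Obj by auto
  \<comment> \<open>\<open>S\<close> is the kernel pair of \<open>f\<close>, obtained as the inverse
    image of the identity relation.\<close>
  have "is_span A Y Y (rel_id A Y)"
    using Y by (simp add: is_span_def rel_id_def)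
  then obtain S where S: "is_relation A X X S" and relS: "\<forall>P\<in>Obj K. rel_at A P S =
      {(x, y). x \<in> hom A P X \<and> y \<in> hom A P X \<and> (f \<cdot> x, f \<cdot> y) \<in> rel_at A P (rel_id A Y)}"
    by (rule inverse_image_relation[OF f(1)])
  have relS: "rel_at A P S = {(x, y). x \<in> hom A P X \<and> y \<in> hom A P X \<and> f \<cdot> x = f \<cdot> y}"
    if "P \<in> Obj K" for P
    using bspec[OF relS that] Comp_hom[OF _ f(1)] Y by (auto simp: rel_at_id)
  have eqS: "equivalence_relation A X S"
    unfolding equivalence_relation_iff_rel_at[OF S]
    by (auto simp: relS equiv_def refl_on_def sym_def trans_def)
  have comp: "f \<cdot>\<^bsub>K\<^esub> r1 = f \<cdot> r1" "f \<cdot>\<^bsub>K\<^esub> r2 = f \<cdot> r2"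
    using r fK comp_K_hom by auto
  have fr: "f \<cdot> r1 \<in> hom K R Y" "f \<cdot> r2 \<in> hom K R Y"
    using r f XY by (auto simp: hom_K_iff Comp_hom)
  have "equiv (hom A P Y) (map_prod ((\<cdot>) f) ((\<cdot>) f) ` rel_at A P (r1, r2))"
    if P: "P \<in> Obj K" for P
  proof (rule equiv_image)
    show "equiv (hom A P X) (rel_at A P (r1, r2))"
      by (rule equiv[OF P])
    show "(\<cdot>) f ` hom A P X = hom A P Y"
    proof
      show "(\<cdot>) f ` hom A P X \<subseteq> hom A P Y"
        using Comp_hom[OF _ f(1)] by auto
      show "hom A P Y \<subseteq> (\<cdot>) f ` hom A P X"
        using projective_lift[OF P f(2,1)] by blast
    qed
    \<comment> \<open>This is one inclusion of the Goursat identity for \<open>T\<close> and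
      \<open>S\<close>, evaluated at \<open>P\<close>.\<close>
    show "rel_at A P (r1, r2) O {(x, y). x \<in> hom A P X \<and> y \<in> hom A P X \<and> f \<cdot> x = f \<cdot> y} O
        rel_at A P (r1, r2) \<subseteq> {(x, y). x \<in> hom A P X \<and> y \<in> hom A P X \<and> f \<cdot> x = f \<cdot> y} O
        rel_at A P (r1, r2) O {(x, y). x \<in> hom A P X \<and> y \<in> hom A P X \<and> f \<cdot> x = f \<cdot> y}"
      using assms eqT eqS Y P unfolding goursat_iff_rel_at relT[OF P, symmetric] relS[OF P, symmetric]
      by blast
  qed
  then show "pseudo_equivalence_relation K Y (f \<cdot>\<^bsub>K\<^esub> r1) (f \<cdot>\<^bsub>K\<^esub> r2)"
    unfolding comp pseudo_equivalence_relation_iff_rel_at[OF fr] rel_at_direct_image[OF span f(1)]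
    by blast
qed

text \<open>In the proof \<open>(t1, t2)\<close> is \<open>S\<close> pulled back to a cover of \<open>X\<close>. The leg \<open>t2\<close> is split by
  reflexivity of \<open>S\<close>, so the weak Goursat property applies to it.\<close>

lemma weak_goursat_trans:
  assumes wg: "weak_goursat_category A K"
    and R: "equivalence_relation A X R" and S: "equivalence_relation A X S" and P: "P \<in> Obj K"
  shows "trans (rel_at A P S O rel_at A P R O rel_at A P S)"
proof -
  have relation: "is_relation A X X R" "is_relation A X X S"
    using R S by (auto simp: equivalence_relation_def)
  note span = relation[THEN relation_is_span]
  have equivR: "equiv (hom A Z X) (rel_at A Z R)" and equivS: "equiv (hom A Z X) (rel_at A Z S)"
    if "Z \<in> Obj K" for Z
    by (rule equiv_rel_at[OF R that], rule equiv_rel_at[OF S that])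
  have "X \<in> Obj A"
    using span Cod_Obj by (auto simp: is_span_def)
  then obtain X' c where X': "X' \<in> Obj K" and c: "c \<in> hom A X' X" "regular_epi A c"
    by (rule cover_exists)
  obtain T t1 t2 where t: "t1 \<in> hom K T X'" "t2 \<in> hom K T X'"
    and relT: "\<forall>Z\<in>Obj K. rel_at A Z (t1, t2) =
      {(x, y). x \<in> hom A Z X' \<and> y \<in> hom A Z X' \<and> (c \<cdot> x, c \<cdot> y) \<in> rel_at A Z S}"
    by (rule inverse_image_exists[OF c(1) X' span(2)])
  have tA: "t1 \<in> hom A T X'" "t2 \<in> hom A T X'" and T: "T \<in> Obj K"
    using t by (auto simp: hom_K_iff)
  have ct: "c \<cdot> t1 \<in> hom A T X"
    using tA c by (auto intro: Comp_hom)
  \<comment> \<open>\<open>(q1, q2)\<close> represents \<open>R\<close> pulled back along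
    \<open>c \<cdot> t1\<close>; an element of \<open>T\<close> amounts to an
    \<open>S\<close>-related pair with chosen lifts to \<open>X'\<close>, and \<open>R\<close> is
    imposed on the first members of two such pairs.\<close>
  obtain Q q1 q2 where q: "q1 \<in> hom K Q T" "q2 \<in> hom K Q T"
    and relQ: "\<forall>Z\<in>Obj K. rel_at A Z (q1, q2) =
      {(x, y). x \<in> hom A Z T \<and> y \<in> hom A Z T \<and> ((c \<cdot> t1) \<cdot> x, (c \<cdot> t1) \<cdot> y) \<in> rel_at A Z R}"
    by (rule inverse_image_exists[OF ct T span(1)])
  have "equiv (hom A Z T) (rel_at A Z (q1, q2))" if Z: "Z \<in> Obj K" for Z
    unfolding bspec[OF relQ Z] using equivR[OF Z] Comp_hom[OF _ ct] by (rule equiv_inverse_image)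
  then have eqQ: "pseudo_equivalence_relation K T q1 q2"
    using pseudo_equivalence_relation_iff_rel_at[OF q] by blast
  have "(Ident A X', Ident A X') \<in> rel_at A X' (t1, t2)"
    unfolding bspec[OF relT X'] using X' K_Obj Ident_hom Comp_hom[OF _ c(1)] equivS[OF X']
    by (auto simp: equiv_def refl_on_def)
  then obtain s where "s \<in> hom A X' T" "t2 \<cdot> s = Ident A X'"
    using tA by (auto simp: rel_at_def hom_def)
  then have "regular_epi A t2"
    using split_epi_regular tA by blast
  then have "pseudo_equivalence_relation K X' (t2 \<cdot>\<^bsub>K\<^esub> q1) (t2 \<cdot>\<^bsub>K\<^esub> q2)"
    using wg eqQ t unfolding weak_goursat_category_def by blast
  then have "pseudo_equivalence_relation K X' (t2 \<cdot> q1) (t2 \<cdot> q2)"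
    using comp_K_hom q t by auto
  moreover have "t2 \<cdot> q1 \<in> hom K Q X'" "t2 \<cdot> q2 \<in> hom K Q X'"
    using q tA X' by (auto simp: hom_K_iff intro: Comp_hom)
  ultimately have "equiv (hom A P X') (rel_at A P (t2 \<cdot> q1, t2 \<cdot> q2))"
    using pseudo_equivalence_relation_iff_rel_at P by blast
  moreover have "is_span A T T (q1, q2)"
    using q unfolding hom_K_iff by (auto simp: is_span_def hom_def)
  ultimately have trans: "trans (map_prod ((\<cdot>) t2) ((\<cdot>) t2) ` rel_at A P (q1, q2))"
    using rel_at_direct_image[OF _ tA(2)] by (auto simp: equiv_def)
  have lift: "\<exists>u. u \<in> hom A P X' \<and> c \<cdot> u = x" if "x \<in> hom A P X" for x
    using projective_lift[OF P c(2,1) that] by blast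
  have assoc: "(c \<cdot> t1) \<cdot> a = c \<cdot> (t1 \<cdot> a)" if "a \<in> hom A P T" for a
    using that tA c by (auto simp: hom_def)
  \<comment> \<open>Pushing \<open>(q1, q2)\<close> forward along \<open>t2\<close> keeps only the
    second members, so \<open>u\<close> and \<open>v\<close> are related when
    \<open>c \<cdot> u\<close> is \<open>S\<close>-related to some \<open>x\<close>,
    \<open>x\<close> is \<open>R\<close>-related to some \<open>y\<close>, and \<open>y\<close> is
    \<open>S\<close>-related to \<open>c \<cdot> v\<close>. In each direction symmetry of
    \<open>S\<close> turns one pair around, since \<open>t1\<close> carries the inner
    points.\<close>
  have image: "(u, v) \<in> map_prod ((\<cdot>) t2) ((\<cdot>) t2) ` rel_at A P (q1, q2) \<longleftrightarrow>
      (c \<cdot> u, c \<cdot> v) \<in> rel_at A P S O rel_at A P R O rel_at A P S"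
    if u: "u \<in> hom A P X'" and v: "v \<in> hom A P X'" for u v
  proof
    assume "(u, v) \<in> map_prod ((\<cdot>) t2) ((\<cdot>) t2) ` rel_at A P (q1, q2)"
    then obtain a b where a: "a \<in> hom A P T" "u = t2 \<cdot> a" and b: "b \<in> hom A P T" "v = t2 \<cdot> b"
      and ab: "((c \<cdot> t1) \<cdot> a, (c \<cdot> t1) \<cdot> b) \<in> rel_at A P R"
      unfolding bspec[OF relQ P] by auto
    have "(t1 \<cdot> a, u) \<in> rel_at A P (t1, t2)" "(t1 \<cdot> b, v) \<in> rel_at A P (t1, t2)"
      using a b tA by (auto simp: rel_at_def hom_def)
    then have "(c \<cdot> (t1 \<cdot> a), c \<cdot> u) \<in> rel_at A P S" "(c \<cdot> (t1 \<cdot> b), c \<cdot> v) \<in> rel_at A P S"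
      unfolding bspec[OF relT P] by auto
    then have "(c \<cdot> u, c \<cdot> (t1 \<cdot> a)) \<in> rel_at A P S" "(c \<cdot> (t1 \<cdot> b), c \<cdot> v) \<in> rel_at A P S"
      using equivS[OF P] by (auto simp: equiv_def dest: symD)
    then show "(c \<cdot> u, c \<cdot> v) \<in> rel_at A P S O rel_at A P R O rel_at A P S"
      using ab unfolding assoc[OF a(1)] assoc[OF b(1)] by blast
  next
    assume "(c \<cdot> u, c \<cdot> v) \<in> rel_at A P S O rel_at A P R O rel_at A P S"
    then obtain x y where xy: "(c \<cdot> u, x) \<in> rel_at A P S" "(x, y) \<in> rel_at A P R"
      "(y, c \<cdot> v) \<in> rel_at A P S"
      by blast
    then have "x \<in> hom A P X" "y \<in> hom A P X"
      using rel_at_subset_hom[OF span(2)] by blast+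
    then obtain x' y' where x': "x' \<in> hom A P X'" "c \<cdot> x' = x" and y': "y' \<in> hom A P X'" "c \<cdot> y' = y"
      using lift by blast
    have "(x, c \<cdot> u) \<in> rel_at A P S"
      using xy(1) equivS[OF P] by (auto simp: equiv_def dest: symD)
    then have "(x', u) \<in> rel_at A P (t1, t2)" "(y', v) \<in> rel_at A P (t1, t2)"
      unfolding bspec[OF relT P] using x' y' u v xy by auto
    then obtain a b where a: "a \<in> hom A P T" "t1 \<cdot> a = x'" "t2 \<cdot> a = u"
      and b: "b \<in> hom A P T" "t1 \<cdot> b = y'" "t2 \<cdot> b = v"
      using tA by (auto simp: rel_at_def hom_def)
    have "(a, b) \<in> rel_at A P (q1, q2)"
      unfolding bspec[OF relQ P] using a b xy(2) x' y' assoc by simp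
    then show "(u, v) \<in> map_prod ((\<cdot>) t2) ((\<cdot>) t2) ` rel_at A P (q1, q2)"
      using a(3) b(3) by (auto simp: image_iff map_prod_def split_beta intro!: bexI)
  qed
  show ?thesis
  proof (rule transI)
    fix x y z
    assume xy: "(x, y) \<in> rel_at A P S O rel_at A P R O rel_at A P S"
      and yz: "(y, z) \<in> rel_at A P S O rel_at A P R O rel_at A P S"
    then have "x \<in> hom A P X" "y \<in> hom A P X" "z \<in> hom A P X"
      using rel_at_subset_hom[OF span(2)] by blast+
    \<comment> \<open>One lift \<open>v\<close> of the middle point serves both pairs, so
      transitivity upstairs in \<open>X'\<close> can be applied.\<close>
    then obtain u v w where u: "u \<in> hom A P X'" "c \<cdot> u = x" and v: "v \<in> hom A P X'" "c \<cdot> v = y"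
      and w: "w \<in> hom A P X'" "c \<cdot> w = z"
      using lift by meson
    have "(u, v) \<in> map_prod ((\<cdot>) t2) ((\<cdot>) t2) ` rel_at A P (q1, q2)"
      unfolding image[OF u(1) v(1)] u(2) v(2) by (rule xy)
    moreover have "(v, w) \<in> map_prod ((\<cdot>) t2) ((\<cdot>) t2) ` rel_at A P (q1, q2)"
      unfolding image[OF v(1) w(1)] v(2) w(2) by (rule yz)
    ultimately have "(u, w) \<in> map_prod ((\<cdot>) t2) ((\<cdot>) t2) ` rel_at A P (q1, q2)"
      by (rule transD[OF trans])
    then show "(x, z) \<in> rel_at A P S O rel_at A P R O rel_at A P S"
      unfolding image[OF u(1) w(1)] u(2) w(2) .
  qed
qed

text \<open>The transitivity result is used twice, with \<open>R\<close> and \<open>S\<close>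
  exchanged, and each use gives one of the two inclusions.\<close>

lemma weak_goursat_imp_goursat:
  assumes "weak_goursat_category A K"
  shows "goursat_category A"
  unfolding goursat_iff_rel_at
proof (intro ballI allI impI)
  fix X R S P assume "equivalence_relation A X R \<and> equivalence_relation A X S" and P: "P \<in> Obj K"
  then have R: "equivalence_relation A X R" and S: "equivalence_relation A X S"
    by auto
  then have "equiv (hom A P X) (rel_at A P R)" "equiv (hom A P X) (rel_at A P S)"
    using equiv_rel_at P by simp_all
  then show "rel_at A P R O rel_at A P S O rel_at A P R = rel_at A P S O rel_at A P R O rel_at A P S"
    using weak_goursat_trans[OF assms R S P] weak_goursat_trans[OF assms S R P]
    by (intro subset_antisym equiv_comp_le_if_trans)
qed

end

theorem proposition4p4:
  fixes A C :: "('o, 'm) cat"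
  assumes "regular_category A"
    and "projective_cover A C"
  shows "goursat_category A \<longleftrightarrow> weak_goursat_category A C"
proof -
  interpret projective_covering A C
    using assms by (simp add: projective_covering_def projective_covering_axioms_def)
  show ?thesis
    using goursat_imp_weak_goursat weak_goursat_imp_goursat by blast
qed

end
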